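(* Let $\mathcal{W}$ be a standard sequence of generating words with bounded spacers such that $X_{\mathcal{W}}$ is aperiodic, and let $\mu$ be the unique invariant probability measure of the minimal Ferenczi subshift $(X_{\mathcal{W}}, S)$. For $a \in \mathcal{A}_{\mathcal{W}}$, we have $\liminf_{m \to +\infty} \mu(\mathcal{T}_m(a)) > 0$ if and only if $$\liminf_{m \to +\infty} \sum_{k=m}^{\infty} \frac{f_k(a)}{Q_{m-1,k}} > 0. \qquad ( * )$$ In particular, $\boldsymbol{\tau}_{\mathcal{W}}$ is of exact finite rank if and only if $( * )$ holds for all $a \in \mathcal{A}_{\mathcal{W}}$.
   Context: $S$ is the shift; a subshift is aperiodic if it is nonempty and contains no shift-periodic point. Ferenczi subshifts. Given nonnegative integers $(q_n)_{n \ge 0}$ (cutting parameters) and $(a_{n,i} : n \ge 0, 0 \le i < q_n)$ (spacer parameters), the sequence of generating words $\mathcal{W} = (w_n)_{n \ge 0}$ over $\{0,1\}$ is $w_0 = 0$, $w_{n+1} = w_n 1^{a_{n,0}} w_n 1^{a_{n,1}} \cdots w_n 1^{a_{n,q_n-1}} w_n$. $X_{\mathcal{W}}$ is the set of $x \in \{0,1\}^{\mathbb{Z}}$ every finite factor of which is a factor of some $w_n$. $\mathcal{W}$ is standard if $q_n \ge 2$ for all $n$. If the spacers are bounded, $(X_{\mathcal{W}},S)$ is minimal (a minimal Ferenczi subshift); it is uniquely ergodic. Directive sequence. $\mathcal{A}_0 = \{0,1\}$, $\mathcal{A}_n = \{a_{N,i} : N \ge n-1, 0 \le i < q_N\}$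 for $n \ge 1$. $\boldsymbol{\tau}_{\mathcal{W}} = (\tau_n : \mathcal{A}_{n+1}^* \to \mathcal{A}_n^* )_{n\ge 0}$ consists of the morphisms $\tau_0(a) = 01^a$ and, for $n \ge 1$, $\tau_n(a) = a_{n-1,1} \cdots a_{n-1,q_{n-1}-1}\, a\, a_{n-1,0}$. Put $\tau_{[n,N)} = \tau_n \circ \cdots \circ \tau_{N-1}$. The alphabets $\mathcal{A}_n$ ($n\ge1$) are decreasing; $\mathcal{A}_{\mathcal{W}}$ denotes their eventual constant value, $\mathcal{A}_n=\mathcal{A}_{\mathcal{W}}$ for $n \ge n_0$, where $n_0 \geq 1$. Towers. $X^{(n)}$ is the set of $x \in \mathcal{A}_n^{\mathbb{Z}}$ all of whose finite factors occur in some $\tau_{[n,N)}(a)$, $N>n$, $a \in \mathcal{A}_N$; one has $X^{(0)} = X_{\mathcal{W}}$. For $a \in \mathcal{A}_n$, $[a] = \{x \in X^{(n)} : x_0 = a\}$ and $\mathcal{T}_n(a) = \bigcup_{0 \le k < |\tau_{[0,n)}(a)|} S^k \tau_{[0,n)}([a])\subseteq X_{\mathcal W}$. Notation: $f_n(a) = \#\{0 \le i < q_{n-1} : a_{n-1,i} = a\}$ for $n \ge 1$, and $Q_{m,n} = \prod_{j=m}^{n-1}(q_j+1)$ for $0 \le m < n$. $\boldsymbol{\tau}_{\mathcal{W}}$ is of exact finite rank if there is a constant $c>0$ such that $\mu(\mathcal{T}_n(a)) \ge c$ for all $n \ge n_0$ and all $a \in \mathcal{A}_{\mathcal{W}}$.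 *)

theory Defs
  imports "HOL-Analysis.Analysis" "HOL-Probability.Probability_Measure" "HOL-Library.Sublist"
begin

section \<open>Bi-infinite sequences, subshifts, invariant measures\<close>

text \<open>All alphabets are finite subsets of \<open>nat\<close>; words are lists over \<open>nat\<close>, and the factor
  relation on words is \<open>sublist\<close>.  The type \<open>int \<Rightarrow> nat\<close> carries the product of the discrete topologies,
  and \<open>borel\<close> on it is the corresponding Borel sigma-algebra.\<close>

definition shift :: "(int \<Rightarrow> nat) \<Rightarrow> int \<Rightarrow> nat" where
  "shift x = (\<lambda>i. x (i + 1))"

definition factors :: "(int \<Rightarrow> nat) \<Rightarrow> nat list set" where
  "factors x = {map x [i..j] | i j. True}"

definition aperiodic :: "(int \<Rightarrow> nat) set \<Rightarrow> bool" where
  "aperiodic X \<longleftrightarrow> X \<noteq> {} \<and> (\<forall>x\<in>X. \<forall>p>0. (shift ^^ p) x \<noteq> x)"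

definition invariant_prob :: "(int \<Rightarrow> nat) set \<Rightarrow> (int \<Rightarrow> nat) measure \<Rightarrow> bool" where
  "invariant_prob X \<mu> \<longleftrightarrow>
     prob_space \<mu> \<and> sets \<mu> = sets (restrict_space borel X) \<and> distr \<mu> \<mu> shift = \<mu>"

section \<open>Morphisms\<close>

definition subst_word :: "(nat \<Rightarrow> nat list) \<Rightarrow> nat list \<Rightarrow> nat list" where
  "subst_word \<sigma> u = concat (map \<sigma> u)"

text \<open>The action of a non-erasing map \<open>h\<close> on words, extending a morphism, on bi-infinite sequences:
  \<open>\<dots> h(x\<^sub>-\<^sub>2) h(x\<^sub>-\<^sub>1) . h(x\<^sub>0) h(x\<^sub>1) \<dots>\<close>, the image of \<open>x\<^sub>0\<close> starting at position 0.  As \<open>h\<close> is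
  non-erasing, \<open>h(x\<^sub>0 \<dots> x\<^sub>i)\<close> covers position \<open>i \<ge> 0\<close>, and \<open>h(x\<^sub>i \<dots> x\<^sub>-\<^sub>1)\<close>, which ends at position
  \<open>-1\<close>, covers position \<open>i < 0\<close>.\<close>

definition subst_seq :: "(nat list \<Rightarrow> nat list) \<Rightarrow> (int \<Rightarrow> nat) \<Rightarrow> int \<Rightarrow> nat" where
  "subst_seq h x i =
     (if 0 \<le> i then h (map x [0..i]) ! nat i
      else let u = h (map x [i..-1]) in u ! nat (int (length u) + i))"

section \<open>Ferenczi subshifts\<close>

text \<open>Throughout, \<open>q n\<close> is the cutting parameter \<open>q\<^sub>n\<close> and \<open>s n i\<close> is the spacer parameter \<open>a\<^sub>n\<^sub>,\<^sub>i\<close>,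
  which is meaningful only for \<open>i < q n\<close>.\<close>

primrec gen_word :: "(nat \<Rightarrow> nat) \<Rightarrow> (nat \<Rightarrow> nat \<Rightarrow> nat) \<Rightarrow> nat \<Rightarrow> nat list" where
  "gen_word q s 0 = [0]"
| "gen_word q s (Suc n) =
     concat (map (\<lambda>i. gen_word q s n @ replicate (s n i) 1) [0..<q n]) @ gen_word q s n"

definition ferenczi_subshift :: "(nat \<Rightarrow> nat) \<Rightarrow> (nat \<Rightarrow> nat \<Rightarrow> nat) \<Rightarrow> (int \<Rightarrow> nat) set" where
  "ferenczi_subshift q s =
     {x. range x \<subseteq> {0, 1} \<and> (\<forall>u\<in>factors x. \<exists>n. sublist u (gen_word q s n))}"

definition standard :: "(nat \<Rightarrow> nat) \<Rightarrow> bool" where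
  "standard q \<longleftrightarrow> (\<forall>n. q n \<ge> 2)"

definition bounded_spacers :: "(nat \<Rightarrow> nat) \<Rightarrow> (nat \<Rightarrow> nat \<Rightarrow> nat) \<Rightarrow> bool" where
  "bounded_spacers q s \<longleftrightarrow> (\<exists>B. \<forall>n. \<forall>i<q n. s n i \<le> B)"

section \<open>The directive sequence and its towers\<close>

definition alphabet :: "(nat \<Rightarrow> nat) \<Rightarrow> (nat \<Rightarrow> nat \<Rightarrow> nat) \<Rightarrow> nat \<Rightarrow> nat set" where
  "alphabet q s n = (if n = 0 then {0, 1} else {s N i | N i. N \<ge> n - 1 \<and> i < q N})"

definition limit_alphabet :: "(nat \<Rightarrow> nat) \<Rightarrow> (nat \<Rightarrow> nat \<Rightarrow> nat) \<Rightarrow> nat set" where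
  "limit_alphabet q s = (THE A. \<forall>\<^sub>F n in sequentially. alphabet q s n = A)"

definition tau :: "(nat \<Rightarrow> nat) \<Rightarrow> (nat \<Rightarrow> nat \<Rightarrow> nat) \<Rightarrow> nat \<Rightarrow> nat \<Rightarrow> nat list" where
  "tau q s n b =
     (if n = 0 then 0 # replicate b 1
      else map (s (n - 1)) [1..<q (n - 1)] @ [b, s (n - 1) 0])"

text \<open>\<open>tau_comp q s n N = \<tau>\<^sub>n \<circ> \<dots> \<circ> \<tau>\<^sub>N\<^sub>-\<^sub>1\<close> as a map on words; the identity for \<open>N = n\<close>.\<close>

definition tau_comp ::
  "(nat \<Rightarrow> nat) \<Rightarrow> (nat \<Rightarrow> nat \<Rightarrow> nat) \<Rightarrow> nat \<Rightarrow> nat \<Rightarrow> nat list \<Rightarrow> nat list" where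
  "tau_comp q s n N = foldr (\<lambda>k. subst_word (tau q s k)) [n..<N]"

definition level_subshift ::
  "(nat \<Rightarrow> nat) \<Rightarrow> (nat \<Rightarrow> nat \<Rightarrow> nat) \<Rightarrow> nat \<Rightarrow> (int \<Rightarrow> nat) set" where
  "level_subshift q s n =
     {x. range x \<subseteq> alphabet q s n \<and>
         (\<forall>u\<in>factors x. \<exists>N>n. \<exists>b\<in>alphabet q s N. sublist u (tau_comp q s n N [b]))}"

definition tower ::
  "(nat \<Rightarrow> nat) \<Rightarrow> (nat \<Rightarrow> nat \<Rightarrow> nat) \<Rightarrow> nat \<Rightarrow> nat \<Rightarrow> (int \<Rightarrow> nat) set" where
  "tower q s n b =
     (\<Union>k<length (tau_comp q s 0 n [b]).
        (shift ^^ k) ` subst_seq (tau_comp q s 0 n) ` {x \<in> level_subshift q s n. x 0 = b})"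

text \<open>Here \<open>n\<^sub>0\<close> is a level from which on the alphabets equal the limit alphabet.\<close>

definition exact_finite_rank ::
  "(nat \<Rightarrow> nat) \<Rightarrow> (nat \<Rightarrow> nat \<Rightarrow> nat) \<Rightarrow> (int \<Rightarrow> nat) measure \<Rightarrow> nat \<Rightarrow> bool" where
  "exact_finite_rank q s \<mu> n\<^sub>0 \<longleftrightarrow>
     (\<exists>c>0. \<forall>n\<ge>n\<^sub>0. \<forall>b\<in>limit_alphabet q s. measure \<mu> (tower q s n b) \<ge> c)"

section \<open>Spacer frequencies\<close>

text \<open>\<open>spacer_count q s n b\<close> is \<open>f\<^sub>n(b)\<close>; it is meaningful only for \<open>n \<ge> 1\<close>.\<close>

definition spacer_count :: "(nat \<Rightarrow> nat) \<Rightarrow> (nat \<Rightarrow> nat \<Rightarrow> nat) \<Rightarrow> nat \<Rightarrow> nat \<Rightarrow> nat" where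
  "spacer_count q s n b = card {i. i < q (n - 1) \<and> s (n - 1) i = b}"

definition cut_prod :: "(nat \<Rightarrow> nat) \<Rightarrow> nat \<Rightarrow> nat \<Rightarrow> nat" where
  "cut_prod q m n = (\<Prod>j=m..<n. q j + 1)"

text \<open>The series \<open>\<Sum>\<^sub>k\<^sub>\<ge>\<^sub>m f\<^sub>k(b) / Q\<^sub>m\<^sub>-\<^sub>1\<^sub>,\<^sub>k\<close>, reindexed from 0.  It converges for standard \<open>q\<close>, being
  dominated by a geometric series.  The meaningless term \<open>m = 0\<close> does not affect the lower limit below.\<close>

definition spacer_series :: "(nat \<Rightarrow> nat) \<Rightarrow> (nat \<Rightarrow> nat \<Rightarrow> nat) \<Rightarrow> nat \<Rightarrow> nat \<Rightarrow> real" where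
  "spacer_series q s b m =
     (\<Sum>k. real (spacer_count q s (m + k) b) / real (cut_prod q (m - 1) (m + k)))"

definition spacer_condition :: "(nat \<Rightarrow> nat) \<Rightarrow> (nat \<Rightarrow> nat \<Rightarrow> nat) \<Rightarrow> nat \<Rightarrow> bool" where
  "spacer_condition q s b \<longleftrightarrow> liminf (\<lambda>m. ereal (spacer_series q s b m)) > 0"

end

theory Submission
  imports Defs
begin

text \<open>Let \<open>E\<^sub>n(b)\<close> be the base of the tower \<open>\<T>\<^sub>n(b)\<close> and \<open>h\<^sub>n = \<tau>\<^sub>0 \<circ> \<dots> \<circ> \<tau>\<^sub>n\<^sub>-\<^sub>1\<close>.  For \<open>n \<ge> 1\<close> all positions
  but one of \<open>\<tau>\<^sub>n(a)\<close> are independent of \<open>a\<close>, so a point of \<open>X\<^sup>(\<^sup>n\<^sup>)\<close> with two desubstitutions is periodic,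
  while \<open>\<tau>\<^sub>0\<close> is decoded from the zeros.
  Hence aperiodicity makes every \<open>\<tau>\<^sub>n\<close> recognizable, and \<open>E\<^sub>n(b)\<close> is a disjoint union of shifted bases
  \<open>E\<^sub>n\<^sub>+\<^sub>1(c)\<close>, one for each occurrence of \<open>b\<close> in some \<open>\<tau>\<^sub>n(c)\<close>.  With \<open>M\<^sub>n = \<Sum>\<^sub>b \<mu>(E\<^sub>n(b))\<close> this gives
  \<open>M\<^sub>n = (q\<^sub>n\<^sub>-\<^sub>1 + 1) M\<^sub>n\<^sub>+\<^sub>1\<close> and \<open>\<mu>(E\<^sub>n(b)) = f\<^sub>n(b) M\<^sub>n\<^sub>+\<^sub>1 + \<mu>(E\<^sub>n\<^sub>+\<^sub>1(b))\<close>, whose iteration shows that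
  \<open>\<mu>(E\<^sub>n(b)) / M\<^sub>n\<close> is the spacer series.  Since \<open>h\<^sub>n(a)\<close> is conjugate to \<open>w\<^sub>n\<^sub>-\<^sub>1 1\<^sup>a\<close>, all towers of one level
  have comparable heights, so \<open>\<mu>(\<T>\<^sub>n(b))\<close> is comparable to the spacer series.\<close>

section \<open>Images of bi-infinite sequences\<close>

lemma subst_word_simps [simp]:
  "subst_word \<sigma> [] = []"
  "subst_word \<sigma> (a # u) = \<sigma> a @ subst_word \<sigma> u"
  "subst_word \<sigma> (u @ v) = subst_word \<sigma> u @ subst_word \<sigma> v"
  by (simp_all add: subst_word_def)

lemma subst_word_subst_word:
  "subst_word \<sigma> (subst_word \<rho> u) = subst_word (\<lambda>a. subst_word \<sigma> (\<rho> a)) u"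
  by (induction u) auto

lemma sublist_subst_word: "sublist u v \<Longrightarrow> sublist (subst_word \<sigma> u) (subst_word \<sigma> v)"
  unfolding sublist_def by (metis subst_word_simps(3))

lemma set_subst_word: "set (subst_word \<sigma> u) = (\<Union>a\<in>set u. set (\<sigma> a))"
  by (simp add: subst_word_def)

lemma length_le_length_subst_word:
  assumes "\<And>a. \<sigma> a \<noteq> []"
  shows "length u \<le> length (subst_word \<sigma> u)"
proof (induction u)
  case (Cons a u)
  have "length (\<sigma> a) \<ge> 1" using assms[of a] by (simp add: Suc_le_eq)
  with Cons have "Suc (length u) \<le> length (\<sigma> a) + length (subst_word \<sigma> u)" by linarith
  then show ?case by simp
qed simp

lemma shift_funpow: "(shift ^^ k) x i = x (i + int k)"
  by (induction k arbitrary: i) (auto simp: shift_def algebra_simps)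

lemma inj_shift: "inj shift"
proof (rule injI)
  fix x y :: "int \<Rightarrow> nat"
  assume "shift x = shift y"
  then have "shift x (i - 1) = shift y (i - 1)" for i by simp
  then show "x = y" by (simp add: shift_def fun_eq_iff)
qed

text \<open>\<open>cuts \<sigma> y x P\<close>: \<open>x\<close> is the image of \<open>y\<close> under \<open>\<sigma>\<close>, and the image of \<open>y\<^sub>i\<close> starts at
  position \<open>P i\<close>.\<close>

definition cuts ::
  "(nat \<Rightarrow> nat list) \<Rightarrow> (int \<Rightarrow> nat) \<Rightarrow> (int \<Rightarrow> nat) \<Rightarrow> (int \<Rightarrow> int) \<Rightarrow> bool" where
  "cuts \<sigma> y x P \<longleftrightarrow> P 0 = 0 \<and> (\<forall>i. P (i + 1) = P i + int (length (\<sigma> (y i)))) \<and>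
     (\<forall>i. \<forall>j<length (\<sigma> (y i)). x (P i + int j) = \<sigma> (y i) ! j)"

text \<open>Every image has at least one letter, so cut points advance at least as fast as indices.
  Around the origin this reads \<open>P b \<ge> b\<close> for \<open>b \<ge> 0\<close> and
  \<open>P a \<le> a\<close> for \<open>a \<le> 0\<close>.\<close>

lemma cuts_mono:
  assumes "cuts \<sigma> y x P" "\<And>a. \<sigma> a \<noteq> []" "a \<le> b"
  shows "P a + (b - a) \<le> P b"
  using assms(3)
proof (induction b rule: int_ge_induct)
  case (step i)
  have "P (i + 1) = P i + int (length (\<sigma> (y i)))" "length (\<sigma> (y i)) > 0"
    using assms by (auto simp: cuts_def)
  with step show ?case by linarith
qed simp

text \<open>The blocks leave no gap: one step right or left stays in a block or enters the
  neighbouring one at its first or last letter, so induction in both directions from 0 reaches every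
  integer.\<close>

lemma cuts_cover:
  assumes "cuts \<sigma> y x P" "\<And>a. \<sigma> a \<noteq> []"
  shows "\<exists>i j. k = P i + int j \<and> j < length (\<sigma> (y i))"
proof -
  have P: "P 0 = 0" "\<And>i. P (i + 1) = P i + int (length (\<sigma> (y i)))"
    using assms(1) by (auto simp: cuts_def)
  have pos: "length (\<sigma> a) > 0" for a using assms(2) by simp
  show ?thesis
  proof (induction k rule: int_induct[where k = 0])
    case base
    show ?case using P(1) pos by (intro exI[of _ 0]) auto
  next
    case (step1 k)
    then obtain i j where ij: "k = P i + int j" "j < length (\<sigma> (y i))" by auto
    show ?case
    proof (cases "Suc j < length (\<sigma> (y i))")
      case True
      then show ?thesis using ij by (intro exI[of _ i] exI[of _ "Suc j"]) auto
    next
      case False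
      then show ?thesis using ij pos P(2)[of i] by (intro exI[of _ "i + 1"] exI[of _ 0]) auto
    qed
  next
    case (step2 k)
    then obtain i j where ij: "k = P i + int j" "j < length (\<sigma> (y i))" by auto
    show ?case
    proof (cases j)
      case 0
      have "P i = P (i - 1) + int (length (\<sigma> (y (i - 1))))" using P(2)[of "i - 1"] by simp
      then show ?thesis using ij 0 pos[of "y (i - 1)"]
        by (intro exI[of _ "i - 1"] exI[of _ "length (\<sigma> (y (i - 1))) - 1"])
          (auto simp: of_nat_diff Suc_le_eq)
    next
      case (Suc j')
      then show ?thesis using ij by (intro exI[of _ i] exI[of _ j']) auto
    qed
  qed
qed

lemma cuts_unique:
  assumes "cuts \<sigma> y x P" "cuts \<sigma> y x' P'" "\<And>a. \<sigma> a \<noteq> []"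
  shows "x = x'" "P = P'"
proof -
  have P: "P 0 = 0" "\<And>i. P (i + 1) = P i + int (length (\<sigma> (y i)))"
    "P' 0 = 0" "\<And>i. P' (i + 1) = P' i + int (length (\<sigma> (y i)))"
    using assms by (auto simp: cuts_def)
  have "P i = P' i" for i
  proof (induction i rule: int_induct[where k = 0])
    case (step2 i)
    then show ?case using P(2)[of "i - 1"] P(4)[of "i - 1"] by simp
  qed (use P in auto)
  then show PP: "P = P'" by auto
  show "x = x'"
  proof
    fix k
    obtain i j where ij: "k = P i + int j" "j < length (\<sigma> (y i))"
      using cuts_cover[OF assms(1,3)] by blast
    then show "x k = x' k" using assms(1,2) PP by (simp add: cuts_def)
  qed
qed

text \<open>The bridge from the window formula defining \<open>subst_seq\<close> to the block
  description by \<open>cuts\<close>.\<close>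

lemma cuts_exists:
  assumes ne: "\<And>a. \<sigma> a \<noteq> []"
  shows "\<exists>P. cuts \<sigma> y (subst_seq (subst_word \<sigma>) y) P"
proof -
  let ?l = "\<lambda>a b. int (length (subst_word \<sigma> (map y [a..b])))"
  \<comment> \<open>The signed length of the image of the letters between 0 and \<open>i\<close>;
    the two cases mirror the two branches of \<open>subst_seq\<close>.\<close>
  define P where "P i = (if 0 \<le> i then ?l 0 (i - 1) else - ?l i (-1))" for i
  have P1: "P (i + 1) = P i + int (length (\<sigma> (y i)))" for i
  proof (cases "0 \<le> i")
    case True
    then show ?thesis using upto_rec2[of 0 i] by (simp add: P_def)
  next
    case False
    then have "[i..-1] = i # [i + 1..-1]" by (intro upto_rec1) simp
    then show ?thesis using False by (auto simp: P_def)
  qed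
  have "subst_seq (subst_word \<sigma>) y (P i + int j) = \<sigma> (y i) ! j" if j: "j < length (\<sigma> (y i))" for i j
  proof (cases "0 \<le> i")
    case True
    let ?k = "P i + int j"
    \<comment> \<open>Non-erasing images make the window \<open>[0..?k]\<close> read by
      \<open>subst_seq\<close> long enough to contain letter \<open>i\<close>; the letters after
      \<open>i\<close> do not affect position \<open>?k\<close>.\<close>
    have "i \<le> P i"
      using length_le_length_subst_word[of \<sigma> "map y [0..i-1]"] ne True by (simp add: P_def)
    then have "[0..?k] = [0..i-1] @ [i..?k]" "[i..?k] = i # [i + 1..?k]"
      using True by (auto intro: upto_split1 upto_rec1)
    then have e: "subst_word \<sigma> (map y [0..?k]) =
        subst_word \<sigma> (map y [0..i-1]) @ \<sigma> (y i) @ subst_word \<sigma> (map y [i+1..?k])" by simp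
    have "0 \<le> ?k" using True by (simp add: P_def)
    moreover have "nat ?k = length (subst_word \<sigma> (map y [0..i-1])) + j" using True by (simp add: P_def)
    ultimately show ?thesis using j by (simp add: subst_seq_def e nth_append)
  next
    case False
    let ?k = "P i + int j"
    have r: "[i..-1] = i # [i + 1..-1]" using False by (intro upto_rec1) simp
    have Pi: "P i = - int (length (\<sigma> (y i))) - ?l (i + 1) (-1)" using False by (simp add: P_def r)
    \<comment> \<open>Here the window is \<open>[?k..-1]\<close>, and it contains letter
      \<open>i\<close> because \<open>?k < P (i + 1)\<close>.\<close>
    have "P (i + 1) \<le> i + 1"
      using length_le_length_subst_word[of \<sigma> "map y [i+1..-1]"] ne False by (auto simp: P_def)
    then have k: "?k < 0" "?k \<le> i" using P1[of i] j False by auto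
    have "[?k..-1] = [?k..i-1] @ i # [i + 1..-1]"
      using upto_split1[of ?k i "-1"] k False r by simp
    then have e: "subst_word \<sigma> (map y [?k..-1]) =
        subst_word \<sigma> (map y [?k..i-1]) @ \<sigma> (y i) @ subst_word \<sigma> (map y [i+1..-1])" by simp
    have "nat (?l ?k (-1) + ?k) = length (subst_word \<sigma> (map y [?k..i-1])) + j"
      unfolding e using Pi by simp
    moreover have "\<not> 0 \<le> ?k" using k by simp
    ultimately show ?thesis using j unfolding subst_seq_def Let_def by (simp add: e nth_append)
  qed
  then have "cuts \<sigma> y (subst_seq (subst_word \<sigma>) y) P"
    using P1 by (auto simp: cuts_def P_def)
  then show ?thesis by blast
qed

lemma cuts_word:
  assumes "cuts \<sigma> y x P" "\<And>a. \<sigma> a \<noteq> []" "a \<le> b"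
  shows "map x [P a..P b - 1] = subst_word \<sigma> (map y [a..b - 1])"
  using assms(3)
proof (induction b rule: int_ge_induct)
  case (step b)
  have len: "P (b + 1) = P b + int (length (\<sigma> (y b)))"
    using assms(1) by (simp add: cuts_def)
  have "P a \<le> P b" using cuts_mono[OF assms(1,2) step(1)] step(1) by linarith
  moreover have "length (\<sigma> (y b)) > 0" using assms(2) by simp
  ultimately have "[P a..P (b + 1) - 1] = [P a..P b - 1] @ [P b..P (b + 1) - 1]"
    using len by (intro upto_split1) linarith+
  moreover have "map x [P b..P (b + 1) - 1] = \<sigma> (y b)"
    using assms(1) len by (intro nth_equalityI) (auto simp: cuts_def nth_upto)
  moreover have "[a..b] = [a..b - 1] @ [b]" using step(1) by (intro upto_rec2)
  ultimately show ?case using step by simp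
qed simp

lemma cutsI:
  assumes "P 0 = 0" "\<And>i. P i \<le> P (i + 1)"
    "\<And>i. map x [P i..P (i + 1) - 1] = \<sigma> (y i)"
  shows "cuts \<sigma> y x P"
proof -
  have "P (i + 1) = P i + int (length (\<sigma> (y i)))" for i
    using assms(2)[of i] by (simp flip: assms(3))
  moreover have "x (P i + int j) = \<sigma> (y i) ! j" if "j < length (\<sigma> (y i))" for i j
    using that by (simp flip: assms(3))
  ultimately show ?thesis using assms(1) by (simp add: cuts_def)
qed

text \<open>The block structure is re-rooted at the cut point \<open>P j\<close>, which equals the
  length of the image of the first \<open>j\<close> letters.\<close>

lemma cuts_shift:
  assumes "cuts \<sigma> y x P" "\<And>a. \<sigma> a \<noteq> []"
  shows "cuts \<sigma> ((shift ^^ j) y) ((shift ^^ length (subst_word \<sigma> (map y [0..int j - 1]))) x)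
           (\<lambda>i. P (i + int j) - P (int j))"
proof -
  have "P 0 = 0" using assms(1) by (simp add: cuts_def)
  then have "length (map x [P 0..P (int j) - 1]) = nat (P (int j))" "0 \<le> P (int j)"
    using cuts_mono[OF assms, of 0 "int j"] by auto
  then have "int (length (subst_word \<sigma> (map y [0..int j - 1]))) = P (int j)"
    using cuts_word[OF assms, of 0 "int j"] by auto
  moreover have "P (i + 1 + int j) = P (i + int j) + int (length (\<sigma> (y (i + int j))))" for i
    using assms(1) unfolding cuts_def by (metis add.commute add.left_commute)
  moreover have "x (P (i + int j) + int k) = \<sigma> (y (i + int j)) ! k"
    if "k < length (\<sigma> (y (i + int j)))" for i k
    using assms(1) that by (simp add: cuts_def)
  ultimately show ?thesis by (simp add: cuts_def shift_funpow)
qed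

lemma cuts_comp:
  assumes "cuts \<rho> y z R" "cuts \<sigma> z x P" "\<And>a. \<rho> a \<noteq> []" "\<And>a. \<sigma> a \<noteq> []"
  shows "cuts (\<lambda>a. subst_word \<sigma> (\<rho> a)) y x (\<lambda>i. P (R i))"
proof (rule cutsI)
  show "P (R 0) = 0" using assms by (simp add: cuts_def)
  fix i
  have R: "R i \<le> R (i + 1)" using cuts_mono[OF assms(1,3), of i "i + 1"] by simp
  show "P (R i) \<le> P (R (i + 1))" using cuts_mono[OF assms(2,4) R] R by simp
  have "map z [R i..R (i + 1) - 1] = \<rho> (y i)"
    using cuts_word[OF assms(1,3), of i "i + 1"] by simp
  then show "map x [P (R i)..P (R (i + 1)) - 1] = subst_word \<sigma> (\<rho> (y i))"
    using cuts_word[OF assms(2,4) R] by simp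
qed

lemma subst_seq_eqI:
  assumes "cuts \<sigma> y x P" "\<And>a. \<sigma> a \<noteq> []"
  shows "subst_seq (subst_word \<sigma>) y = x"
  using cuts_exists[of \<sigma> y] cuts_unique[OF assms(1) _ assms(2)] assms(2) by metis

lemma subst_seq_shift:
  assumes "\<And>a. \<sigma> a \<noteq> []"
  shows "subst_seq (subst_word \<sigma>) ((shift ^^ j) y) =
    (shift ^^ length (subst_word \<sigma> (map y [0..int j - 1]))) (subst_seq (subst_word \<sigma>) y)"
  using cuts_exists[of \<sigma> y] cuts_shift[of \<sigma> y] subst_seq_eqI assms by metis

lemma subst_seq_subst_seq:
  assumes "\<And>a. \<rho> a \<noteq> []" "\<And>a. \<sigma> a \<noteq> []"
  shows "subst_seq (subst_word \<sigma>) (subst_seq (subst_word \<rho>) y) =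
    subst_seq (\<lambda>u. subst_word \<sigma> (subst_word \<rho> u)) y"
proof -
  let ?z = "subst_seq (subst_word \<rho>) y"
  obtain R P where "cuts \<rho> y ?z R" "cuts \<sigma> ?z (subst_seq (subst_word \<sigma>) ?z) P"
    using cuts_exists assms by meson
  then have c: "cuts (\<lambda>a. subst_word \<sigma> (\<rho> a)) y (subst_seq (subst_word \<sigma>) ?z) (\<lambda>i. P (R i))"
    using cuts_comp assms by blast
  have "subst_word \<sigma> (\<rho> a) \<noteq> []" for a
    using length_le_length_subst_word[of \<sigma> "\<rho> a"] assms by auto
  from subst_seq_eqI[OF c this] show ?thesis by (simp add: subst_word_subst_word)
qed

lemma subst_seq_nth:
  assumes "\<And>a. \<sigma> a \<noteq> []" "j < length (\<sigma> (y 0))"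
  shows "subst_seq (subst_word \<sigma>) y (int j) = \<sigma> (y 0) ! j"
  using cuts_exists[of \<sigma> y] assms by (fastforce simp: cuts_def dest: spec[of _ 0])

lemma map_subst_seq_prefix:
  assumes "\<And>a. \<sigma> a \<noteq> []" "j \<le> length (\<sigma> (y 0))"
  shows "map (subst_seq (subst_word \<sigma>) y) [0..int j - 1] = take j (\<sigma> (y 0))"
  using assms by (intro nth_equalityI) (auto simp: subst_seq_nth)

section \<open>Topology of sequence spaces\<close>

text \<open>With discrete coordinates the set is a union of cylinders over \<open>F\<close>, each a
  finite intersection of open sets.\<close>

lemma open_finitely_determined:
  fixes Q :: "('i \<Rightarrow> 'a::discrete_topology) \<Rightarrow> bool"
  assumes "finite F" "\<And>x y. (\<And>k. k \<in> F \<Longrightarrow> x k = y k) \<Longrightarrow> Q x \<Longrightarrow> Q y"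
  shows "open {x. Q x}"
proof -
  have "open (\<Inter>k\<in>F. (\<lambda>y. y k) -` {x k})" for x :: "'i \<Rightarrow> 'a"
    using assms(1) by (intro open_INT ballI open_vimage) (auto simp: open_discrete)
  moreover have "{x. Q x} = (\<Union>x\<in>{x. Q x}. \<Inter>k\<in>F. (\<lambda>y. y k) -` {x k})"
  proof (intro equalityI subsetI)
    fix y assume "y \<in> (\<Union>x\<in>{x. Q x}. \<Inter>k\<in>F. (\<lambda>y. y k) -` {x k})"
    then obtain x where "Q x" "\<And>k. k \<in> F \<Longrightarrow> x k = y k" by fastforce
    then show "y \<in> {x. Q x}" using assms(2) by blast
  qed auto
  ultimately show ?thesis by (metis (no_types, lifting) open_UN)
qed

lemma closed_finitely_determined:
  fixes Q :: "('i \<Rightarrow> 'a::discrete_topology) \<Rightarrow> bool"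
  assumes "finite F" "\<And>x y. (\<And>k. k \<in> F \<Longrightarrow> x k = y k) \<Longrightarrow> Q x \<Longrightarrow> Q y"
  shows "closed {x. Q x}"
proof -
  have "open {x. \<not> Q x}"
    using assms(1) by (rule open_finitely_determined) (use assms(2) in metis)
  moreover have "- {x. Q x} = {x. \<not> Q x}" by auto
  ultimately show ?thesis by (simp add: closed_def)
qed

lemma continuous_on_finitely_determined:
  fixes g :: "('i \<Rightarrow> 'a::discrete_topology) \<Rightarrow> 'b::topological_space"
  assumes "finite F" "\<And>x y. (\<And>k. k \<in> F \<Longrightarrow> x k = y k) \<Longrightarrow> g x = g y"
  shows "continuous_on UNIV g"
proof -
  have "open {x. g x \<in> B}" for B
    using assms(1) by (rule open_finitely_determined) (use assms(2) in metis)
  then show ?thesis by (simp add: continuous_on_open_vimage vimage_def)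
qed

lemma compact_functions_into_finite:
  assumes "finite B"
  shows "compact {x :: 'i \<Rightarrow> 'a::topological_space. range x \<subseteq> B}"
proof -
  have "{x :: 'i \<Rightarrow> 'a. range x \<subseteq> B} = (\<Pi>\<^sub>E i\<in>UNIV. B)" by auto
  moreover have "compactin (product_topology (\<lambda>i::'i. euclidean) UNIV) (\<Pi>\<^sub>E i\<in>UNIV. B)"
    using assms by (simp add: compactin_PiE finite_imp_compact)
  ultimately show ?thesis by (simp add: euclidean_product_topology)
qed

text \<open>The Hausdorff property passes from the coordinate space to
  \<open>product_topology\<close>, which is the topology of the function type; compact sets are
  closed there.\<close>

lemma compact_imp_closed_fun:
  fixes K :: "('i \<Rightarrow> 'a::t2_space) set"
  assumes "compact K"
  shows "closed K"
proof -
  have "Hausdorff_space (euclidean :: 'a topology)"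
    unfolding Hausdorff_space_def
  proof (intro allI impI)
    fix x y :: 'a
    assume "x \<in> topspace euclidean \<and> y \<in> topspace euclidean \<and> x \<noteq> y"
    then obtain U V where "open U" "open V" "x \<in> U" "y \<in> V" "U \<inter> V = {}"
      using hausdorff[of x y] by auto
    then show "\<exists>U V. openin euclidean U \<and> openin euclidean V \<and> x \<in> U \<and> y \<in> V \<and> disjnt U V"
      by (intro exI[of _ U] exI[of _ V]) (simp add: disjnt_def)
  qed
  then have "Hausdorff_space (product_topology (\<lambda>i::'i. euclidean :: 'a topology) UNIV)"
    by (simp add: Hausdorff_space_product_topology)
  then have "Hausdorff_space (euclidean :: ('i \<Rightarrow> 'a) topology)"
    unfolding euclidean_product_topology .
  then show ?thesis using compactin_imp_closedin[of euclidean K] assms by simp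
qed

text \<open>Coordinate \<open>i\<close> of the image reads only the letters between 0 and
  \<open>i\<close>, whatever \<open>H\<close> is.\<close>

lemma continuous_on_subst_seq: "continuous_on UNIV (subst_seq H)"
proof (rule continuous_on_coordinatewise_then_product)
  fix i
  show "continuous_on UNIV (\<lambda>x. subst_seq H x i)"
  proof (rule continuous_on_finitely_determined)
    fix x y :: "int \<Rightarrow> nat"
    assume "\<And>k. k \<in> {0..i} \<union> {i..-1} \<Longrightarrow> x k = y k"
    then have e: "map x [0..i] = map y [0..i]" "map x [i..-1] = map y [i..-1]" by auto
    show "subst_seq H x i = subst_seq H y i" unfolding subst_seq_def e ..
  qed simp
qed

lemma continuous_on_shift: "continuous_on UNIV shift"
  unfolding shift_def
  by (intro continuous_on_coordinatewise_then_product continuous_on_product_coordinates)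

lemma compact_shift_funpow: "compact K \<Longrightarrow> compact ((shift ^^ k) ` K)"
proof (induction k)
  case (Suc k)
  then have "compact (shift ` (shift ^^ k) ` K)"
    using compact_continuous_image continuous_on_subset[OF continuous_on_shift] by blast
  then show ?case by (simp add: image_comp)
qed simp

section \<open>The directive sequence\<close>

lemma tau_nonempty [simp]: "tau q s n b \<noteq> []"
  by (simp add: tau_def)

lemma tau_comp_refl [simp]: "tau_comp q s n n u = u"
  by (simp add: tau_comp_def)

lemma tau_comp_Cons:
  "n < N \<Longrightarrow> tau_comp q s n N u = subst_word (tau q s n) (tau_comp q s (Suc n) N u)"
  by (simp add: tau_comp_def upt_conv_Cons)

lemma tau_comp_Suc:
  "n \<le> N \<Longrightarrow> tau_comp q s n (Suc N) u = tau_comp q s n N (subst_word (tau q s N) u)"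
  by (simp add: tau_comp_def)

lemma tau_comp_conv_subst_word:
  "tau_comp q s n N = subst_word (\<lambda>b. tau_comp q s n N [b])"
proof -
  have "foldr (\<lambda>k. subst_word (tau q s k)) ks u =
      subst_word (\<lambda>b. foldr (\<lambda>k. subst_word (tau q s k)) ks [b]) u" for ks u
  proof (induction ks)
    case Nil
    show ?case by (induction u) auto
  next
    case (Cons k ks)
    then show ?case by (simp add: subst_word_subst_word)
  qed
  then show ?thesis unfolding tau_comp_def by (intro ext)
qed

text \<open>The letter map is kept as an opaque \<open>\<sigma>\<close>: the preceding equation has
  \<open>tau_comp q s n N\<close> on both sides and would rewrite without end.\<close>

lemma tau_comp_morphism:
  obtains \<sigma> where "tau_comp q s n N = subst_word \<sigma>" "\<And>b. \<sigma> b = tau_comp q s n N [b]"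
  by (rule that[OF tau_comp_conv_subst_word]) (rule refl)

lemma tau_comp_append: "tau_comp q s n N (u @ v) = tau_comp q s n N u @ tau_comp q s n N v"
  by (rule tau_comp_morphism[of q s n N]) simp

lemma tau_comp_Nil [simp]: "tau_comp q s n N [] = []"
  by (rule tau_comp_morphism[of q s n N]) simp

lemma tau_comp_nonempty [simp]: "tau_comp q s n N [b] \<noteq> []"
proof -
  have "u \<noteq> [] \<Longrightarrow> foldr (\<lambda>k. subst_word (tau q s k)) ks u \<noteq> []" for ks u
  proof (induction ks)
    case (Cons k ks)
    have "length (subst_word (tau q s k) v) \<ge> length v" for v
      by (rule length_le_length_subst_word) simp
    from this[of "foldr (\<lambda>k. subst_word (tau q s k)) ks u"] Cons show ?case by auto
  qed simp
  then show ?thesis by (simp add: tau_comp_def)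
qed

lemma sublist_tau_comp: "sublist u v \<Longrightarrow> sublist (tau_comp q s n N u) (tau_comp q s n N v)"
  by (rule tau_comp_morphism[of q s n N]) (simp add: sublist_subst_word)

lemma subst_seq_tau_comp_refl [simp]: "subst_seq (tau_comp q s n n) x = x"
  by (rule ext) (auto simp: subst_seq_def Let_def)

lemma subst_seq_tau_comp_Suc:
  "subst_seq (tau_comp q s 0 (Suc n)) y =
     subst_seq (tau_comp q s 0 n) (subst_seq (subst_word (tau q s n)) y)"
proof (rule tau_comp_morphism[of q s 0 n])
  fix \<sigma>
  assume \<sigma>: "tau_comp q s 0 n = subst_word \<sigma>" "\<And>b. \<sigma> b = tau_comp q s 0 n [b]"
  have "\<sigma> b \<noteq> []" for b by (simp only: \<sigma>(2) tau_comp_nonempty not_False_eq_True)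
  moreover have "tau_comp q s 0 (Suc n) = (\<lambda>u. subst_word \<sigma> (subst_word (tau q s n) u))"
    by (rule ext) (simp only: tau_comp_Suc[OF le0] \<sigma>(1))
  ultimately show ?thesis
    using subst_seq_subst_seq[of "tau q s n" \<sigma> y] by (simp only: \<sigma>(1) tau_nonempty not_False_eq_True)
qed

locale ferenczi =
  fixes q :: "nat \<Rightarrow> nat" and s :: "nat \<Rightarrow> nat \<Rightarrow> nat"
  assumes q_ge: "\<And>n. q n \<ge> 2" and bounded: "bounded_spacers q s"
begin

abbreviation "A \<equiv> alphabet q s"
abbreviation "X \<equiv> level_subshift q s"
abbreviation "W \<equiv> gen_word q s"
abbreviation "h \<equiv> tau_comp q s"
abbreviation "\<tau> \<equiv> tau q s"

definition language :: "nat \<Rightarrow> nat list set" where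
  "language n = {u. \<exists>N>n. \<exists>b\<in>A N. sublist u (h n N [b])}"

lemma spacer_in_alphabet: "i < q N \<Longrightarrow> n \<le> Suc N \<Longrightarrow> 0 < n \<Longrightarrow> s N i \<in> A n"
proof -
  assume "i < q N" "n \<le> Suc N" "0 < n"
  then have "N \<ge> n - 1 \<and> i < q N" by simp
  then have "s N i \<in> {s N i | N i. N \<ge> n - 1 \<and> i < q N}" by blast
  then show "s N i \<in> A n" using \<open>0 < n\<close> by (simp add: alphabet_def)
qed

lemma alphabet_nonempty: "A n \<noteq> {}"
  using spacer_in_alphabet[of 0 n n] q_ge[of n]
  by (cases "n = 0") (auto simp: alphabet_def)

lemma alphabet_antimono: "0 < n \<Longrightarrow> n \<le> N \<Longrightarrow> A N \<subseteq> A n"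
proof
  assume nN: "0 < n" "n \<le> N"
  fix a
  assume "a \<in> A N"
  then obtain K i where "a = s K i" "K \<ge> N - 1" "i < q K" using nN by (auto simp: alphabet_def)
  then show "a \<in> A n" using nN spacer_in_alphabet[of i K n] by simp
qed

lemma alphabet_bounded: "\<exists>B. \<forall>n>0. \<forall>a\<in>A n. a \<le> B"
proof -
  obtain B where B: "\<forall>n. \<forall>i<q n. s n i \<le> B" using bounded by (auto simp: bounded_spacers_def)
  have "a \<le> B" if "n > 0" "a \<in> A n" for n a using that B by (auto simp: alphabet_def)
  then show ?thesis by blast
qed

lemma finite_alphabet: "finite (A n)"
proof (cases "n = 0")
  case False
  then show ?thesis using alphabet_bounded by (metis finite_nat_set_iff_bounded_le neq0_conv)
qed (simp add: alphabet_def)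

lemma set_tau: "b \<in> A (Suc n) \<Longrightarrow> set (\<tau> n b) \<subseteq> A n"
proof (cases n)
  case 0
  then show ?thesis by (auto simp: tau_def alphabet_def)
next
  case (Suc m)
  assume "b \<in> A (Suc n)"
  then have "b \<in> A n" using alphabet_antimono[of n "Suc n"] Suc by auto
  moreover have "s m 0 \<in> A n" using spacer_in_alphabet[of 0 m n] q_ge[of m] Suc by auto
  ultimately show ?thesis using Suc by (auto simp: tau_def intro: spacer_in_alphabet)
qed

lemma set_tau_comp:
  assumes "n \<le> N" "set u \<subseteq> A N"
  shows "set (h n N u) \<subseteq> A n"
  using assms(1)
proof (induction rule: inc_induct)
  case (step n)
  have "set (\<tau> n a) \<subseteq> A n" if "a \<in> set (h (Suc n) N u)" for a
    using set_tau step that by blast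
  then show ?case using step by (simp add: tau_comp_Cons[OF step(2)] set_subst_word UN_least)
qed (use assms(2) in simp)

lemma set_language: "u \<in> language n \<Longrightarrow> set u \<subseteq> A n"
proof -
  assume "u \<in> language n"
  then obtain N b where "N > n" "b \<in> A N" "sublist u (h n N [b])" by (auto simp: language_def)
  then show "set u \<subseteq> A n"
    using set_tau_comp[of n N "[b]"] set_mono_sublist[of u "h n N [b]"] by simp
qed

lemma sublist_language: "v \<in> language n \<Longrightarrow> sublist u v \<Longrightarrow> u \<in> language n"
proof -
  assume "v \<in> language n" "sublist u v"
  then obtain N b where Nb: "N > n" "b \<in> A N" "sublist u (h n N [b])"
    unfolding language_def using sublist_order.order_trans[of u v] by auto
  then show ?thesis unfolding language_def by blast
qed

text \<open>The alphabet condition is absorbed by the one-letter windows, since words of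
  \<open>language n\<close> are over \<open>A n\<close>.\<close>

lemma mem_level_subshift_iff: "x \<in> X n \<longleftrightarrow> (\<forall>a b. map x [a..b] \<in> language n)"
proof
  assume *: "\<forall>a b. map x [a..b] \<in> language n"
  have "x i \<in> A n" for i using set_language[OF *[rule_format, of i i]] by simp
  moreover have "u \<in> language n" if "u \<in> factors x" for u
    using * that by (auto simp: factors_def)
  ultimately show "x \<in> X n" by (auto simp: level_subshift_def language_def)
next
  assume "x \<in> X n"
  moreover have "map x [a..b] \<in> factors x" for a b by (auto simp: factors_def)
  ultimately show "\<forall>a b. map x [a..b] \<in> language n"
    by (simp add: level_subshift_def language_def)
qed

lemma letter_in_alphabet: "x \<in> X n \<Longrightarrow> x i \<in> A n"
  by (auto simp: level_subshift_def)

lemma shift_level_subshift: "x \<in> X n \<Longrightarrow> (shift ^^ k) x \<in> X n"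
proof -
  have "map ((shift ^^ k) x) [a..b] = map x [a + int k..b + int k]" for a b
    by (rule nth_equalityI) (auto simp: shift_funpow algebra_simps)
  then show "x \<in> X n \<Longrightarrow> (shift ^^ k) x \<in> X n" by (simp add: mem_level_subshift_iff)
qed

lemma subst_word_language:
  assumes "u \<in> language (Suc n)"
  shows "subst_word (\<tau> n) u \<in> language n"
proof -
  obtain N b where N: "N > Suc n" "b \<in> A N" "sublist u (h (Suc n) N [b])"
    using assms by (auto simp: language_def)
  then have "sublist (subst_word (\<tau> n) u) (h n N [b])"
    using sublist_subst_word by (simp add: tau_comp_Cons[of n])
  then show ?thesis using N by (auto simp: language_def intro!: exI[of _ N])
qed

text \<open>Each window of the image lies inside the image of some window of \<open>y\<close>, whose
  image is in the language of level \<open>n\<close>.\<close>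

lemma subst_seq_level_subshift:
  assumes y: "y \<in> X (Suc n)"
  shows "subst_seq (subst_word (\<tau> n)) y \<in> X n"
  unfolding mem_level_subshift_iff
proof (intro allI)
  fix a b :: int
  let ?x = "subst_seq (subst_word (\<tau> n)) y"
  obtain P where P: "cuts (\<tau> n) y ?x P" using cuts_exists[of "\<tau> n" y] by auto
  define a' b' where "a' = min a 0" and "b' = max (b + 1) 0"
  have P0: "P 0 = 0" using P by (simp add: cuts_def)
  have "P a' \<le> a" "b + 1 \<le> P b'" "a' \<le> b'"
    using cuts_mono[OF P tau_nonempty, of a' 0] cuts_mono[OF P tau_nonempty, of 0 b'] P0
    by (auto simp: a'_def b'_def)
  then have "map ?x [P a'..P b' - 1] \<in> language n"
    using cuts_word[OF P tau_nonempty, of a' b'] y subst_word_language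
    by (simp add: mem_level_subshift_iff)
  moreover have "sublist [a..b] [P a'..P b' - 1]"
  proof (cases "a \<le> b")
    case True
    have "[P a'..P b' - 1] = [P a'..a - 1] @ [a..b] @ [b + 1..P b' - 1]"
      using True \<open>P a' \<le> a\<close> \<open>b + 1 \<le> P b'\<close> upto_split1[of "P a'" a "P b' - 1"]
        upto_split2[of a b "P b' - 1"] by simp
    then show ?thesis by simp
  qed simp
  ultimately show "map ?x [a..b] \<in> language n"
    using sublist_language map_mono_sublist by blast
qed

lemma subst_seq_tau_comp_level_subshift:
  "y \<in> X n \<Longrightarrow> subst_seq (h 0 n) y \<in> X 0"
  by (induction n arbitrary: y) (auto simp: subst_seq_tau_comp_Suc subst_seq_level_subshift)

section \<open>Conjugacy with the generating words and the identity of X^(0) with X_W\<close>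

text \<open>The words conjugating \<open>\<tau>\<^sub>0 \<circ> \<dots> \<circ> \<tau>\<^sub>n\<close> to the morphism \<open>a \<mapsto> w\<^sub>n 1\<^sup>a\<close>.\<close>

primrec conj_word :: "nat \<Rightarrow> nat list" where
  "conj_word 0 = []"
| "conj_word (Suc n) = W n @ replicate (s n 0) 1 @ conj_word n"

text \<open>Moving the last letter a_(n,0) of \<tau>_(n+1)(a) to the front yields a_(n,0), ...,
  a_(n,q_n-1), a. Replacing each letter b by w_n 1^b turns this into w_(n+1) 1^a. So w_n 1^(a_(n,0))
  conjugates one level, and the conjugating words accumulate by induction.\<close>

lemma conj_word_tau_comp:
  "conj_word n @ h 0 (Suc n) u = subst_word (\<lambda>a. W n @ replicate a 1) u @ conj_word n"
proof (induction n arbitrary: u)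
  case 0
  have "\<tau> 0 = (\<lambda>a. W 0 @ replicate a 1)" by (auto simp: tau_def)
  then show ?case by (simp add: tau_comp_def)
next
  case (Suc n)
  let ?g = "\<lambda>a. W n @ replicate a 1" and ?g' = "\<lambda>a. W (Suc n) @ replicate a 1"
  have g: "?g (s n 0) @ subst_word ?g (\<tau> (Suc n) a) = ?g' a @ ?g (s n 0)" for a
  proof -
    have "[0..<q n] = 0 # [1..<q n]" using q_ge[of n] by (simp add: upt_conv_Cons)
    then show ?thesis
      by (simp add: tau_def subst_word_def comp_def)
  qed
  have "?g (s n 0) @ subst_word ?g (subst_word (\<tau> (Suc n)) u) = subst_word ?g' u @ ?g (s n 0)"
  proof (induction u)
    case (Cons a u)
    have "?g (s n 0) @ subst_word ?g (subst_word (\<tau> (Suc n)) (a # u)) =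
        (?g (s n 0) @ subst_word ?g (\<tau> (Suc n) a)) @ subst_word ?g (subst_word (\<tau> (Suc n)) u)"
      by simp
    also have "\<dots> = ?g' a @ (?g (s n 0) @ subst_word ?g (subst_word (\<tau> (Suc n)) u))"
      unfolding g by simp
    also have "\<dots> = subst_word ?g' (a # u) @ ?g (s n 0)" unfolding Cons by simp
    finally show ?case .
  qed simp
  moreover have "h 0 (Suc (Suc n)) u = h 0 (Suc n) (subst_word (\<tau> (Suc n)) u)"
    by (simp add: tau_comp_Suc)
  moreover have "conj_word (Suc n) @ h 0 (Suc n) v = ?g (s n 0) @ subst_word ?g v @ conj_word n" for v
    using Suc[of v] by simp
  ultimately show ?case by (metis append.assoc conj_word.simps(2))
qed

text \<open>Conjugate words have equal length. These are the tower heights, which therefore differ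
  within one level only by the bounded summand \<open>b\<close>.\<close>

lemma length_tau_comp: "length (h 0 (Suc n) [b]) = length (W n) + b"
  using arg_cong[OF conj_word_tau_comp[of n "[b]"], of length] by simp

lemma gen_word_prefix_rest:
  "prefix (W n) (concat (map (\<lambda>i. W n @ replicate (s n i) 1) [k..<m]) @ W n)"
  by (cases "k < m") (auto simp: upt_conv_Cons)

lemma gen_word_Suc_split:
  assumes "i < q n"
  shows "\<exists>u v. W (Suc n) = u @ (W n @ replicate (s n i) 1 @ W n) @ v"
proof -
  have "[0..<q n] = [0..<i] @ i # [Suc i..<q n]"
    using assms upt_add_eq_append[of 0 i "q n - i"] by (simp add: upt_conv_Cons)
  then show ?thesis using gen_word_prefix_rest[of n "Suc i" "q n"] by (auto elim!: prefixE)
qed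

lemma prefix_gen_word: "n \<le> N \<Longrightarrow> prefix (W n) (W N)"
proof (induction rule: dec_induct)
  case (step N)
  then show ?case using gen_word_prefix_rest[of N 0 "q N"] prefix_order.order_trans by fastforce
qed simp

lemma suffix_gen_word: "n \<le> N \<Longrightarrow> suffix (W n) (W N)"
proof (induction rule: dec_induct)
  case (step N)
  then show ?case using suffix_order.order_trans by (fastforce simp: suffix_def)
qed simp

text \<open>The word w_(n+1) starts with w_n 1^(a_(n,0)) w_n, and by induction the previous
  conjugating word is a prefix of the second w_n.\<close>

lemma prefix_conj_word: "prefix (conj_word n) (W n)"
proof (induction n)
  case (Suc n)
  have "[0..<q n] = 0 # [1..<q n]" using q_ge[of n] by (simp add: upt_conv_Cons)
  moreover have "prefix (conj_word n) (concat (map (\<lambda>i. W n @ replicate (s n i) 1) [1..<q n]) @ W n)"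
    using Suc gen_word_prefix_rest prefix_order.order_trans by blast
  ultimately show ?case by simp
qed simp

text \<open>A letter of \<open>A (Suc n)\<close> is a spacer a_(N,i) with N \<ge> n, so w_(N+1)
  contains w_N 1^b w_N. Since w_N ends and begins with w_n, which begins with
  \<open>conj_word n\<close>, it contains w_n 1^b followed by \<open>conj_word n\<close>, and the
  conjugacy exhibits the image of \<open>b\<close> there.\<close>

lemma sublist_gen_word_tau_comp:
  assumes "b \<in> A (Suc n)"
  shows "\<exists>N. sublist (h 0 (Suc n) [b]) (W N)"
proof -
  obtain N i where N: "b = s N i" "N \<ge> n" "i < q N" using assms by (auto simp: alphabet_def)
  obtain t where t: "W n = conj_word n @ t" using prefix_conj_word by (auto elim: prefixE)
  obtain t1 t2 where t12: "W N = t1 @ W n" "W N = W n @ t2"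
    using prefix_gen_word[OF N(2)] suffix_gen_word[OF N(2)] unfolding suffix_def prefix_def by blast
  obtain u v where "W (Suc N) = u @ (W N @ replicate b 1 @ W N) @ v"
    using gen_word_Suc_split[OF N(3)] N(1) by blast
  also have "\<dots> = u @ (t1 @ W n @ replicate b 1 @ W n @ t2) @ v"
    by (subst t12(1), subst t12(2)) simp
  also have "\<dots> = u @ t1 @ (W n @ replicate b 1 @ conj_word n) @ t @ t2 @ v"
    by (simp add: t)
  also have "W n @ replicate b 1 @ conj_word n = conj_word n @ h 0 (Suc n) [b]"
    using conj_word_tau_comp[of n "[b]"] by simp
  finally have "W (Suc N) = (u @ t1 @ conj_word n) @ h 0 (Suc n) [b] @ t @ t2 @ v" by simp
  then show ?thesis by (metis sublist_appendI)
qed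

text \<open>The two letters \<open>b\<close>, \<open>s n 0\<close> end \<tau>_(n+1)(b). Conjugated,
  their image has a second copy of w_n, which survives cancelling the leading
  \<open>conj_word n\<close>.\<close>

lemma gen_word_in_language: "W n \<in> language 0"
proof -
  obtain b where b: "b \<in> A (Suc (Suc n))" using alphabet_nonempty by blast
  obtain t where t: "W n = conj_word n @ t" using prefix_conj_word by (auto elim: prefixE)
  have "conj_word n @ h 0 (Suc n) [b, s n 0] =
      W n @ replicate b 1 @ W n @ replicate (s n 0) 1 @ conj_word n"
    using conj_word_tau_comp[of n "[b, s n 0]"] by simp
  also have "\<dots> = conj_word n @ (t @ replicate b 1) @ W n @ replicate (s n 0) 1 @ conj_word n"
    by (subst t) simp
  finally have "sublist (W n) (h 0 (Suc n) [b, s n 0])"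
    by (metis append_same_eq same_append_eq sublist_appendI)
  moreover have "sublist [b, s n 0] (subst_word (\<tau> (Suc n)) [b])" by (simp add: tau_def)
  then have "sublist (h 0 (Suc n) [b, s n 0]) (h 0 (Suc (Suc n)) [b])"
    by (subst tau_comp_Suc[of 0 "Suc n"]) (simp_all add: sublist_tau_comp)
  ultimately show ?thesis using b sublist_order.order_trans
    unfolding language_def by blast
qed

lemma level_subshift_0: "X 0 = ferenczi_subshift q s"
proof -
  have *: "u \<in> language 0 \<longleftrightarrow> (\<exists>n. sublist u (W n))" for u
  proof
    assume "u \<in> language 0"
    then obtain N b where "N > 0" "b \<in> A N" "sublist u (h 0 N [b])" by (auto simp: language_def)
    moreover from this obtain K where "sublist (h 0 N [b]) (W K)"
      using sublist_gen_word_tau_comp[of b "N - 1"] by auto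
    ultimately show "\<exists>n. sublist u (W n)"
      using sublist_order.order_trans by blast
  qed (use gen_word_in_language sublist_language in blast)
  have "X 0 = {x. range x \<subseteq> {0, 1} \<and> (\<forall>u\<in>factors x. u \<in> language 0)}"
    by (simp add: level_subshift_def language_def alphabet_def)
  then show ?thesis by (simp add: * ferenczi_subshift_def)
qed

section \<open>Desubstitution\<close>

text \<open>The definition of \<open>language\<close> demands a strictly higher level, so a bare
  letter needs an argument. If b = a_(N,i), then \<open>b\<close> occurs in \<tau>_(N+1)(c) for
  every \<open>c\<close>, and each lower morphism of positive level keeps it, because
  \<tau>_(k+1)(a) contains a.\<close>

lemma singleton_language: "b \<in> A (Suc n) \<Longrightarrow> [b] \<in> language (Suc n)"
proof -
  assume "b \<in> A (Suc n)"
  then obtain N i where N: "b = s N i" "N \<ge> n" "i < q N" by (auto simp: alphabet_def)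
  obtain c where c: "c \<in> A (Suc (Suc N))" using alphabet_nonempty by blast
  have mem: "a \<in> set (\<tau> (Suc k) a)" for a k by (simp add: tau_def)
  have "b \<in> set (h (Suc n) (Suc N) [b])"
    using \<open>N \<ge> n\<close>
  proof (induction rule: inc_induct)
    case (step k)
    then show ?case using mem[of b k] by (auto simp: tau_comp_Cons set_subst_word)
  qed simp
  moreover have "b \<in> set (\<tau> (Suc N) c)"
    using N(1,3) by (cases "i = 0") (auto simp: tau_def)
  then have "set (h (Suc n) (Suc N) [b]) \<subseteq> set (h (Suc n) (Suc (Suc N)) [c])"
    using N(2) set_mono_sublist[OF sublist_tau_comp[of "[b]" "\<tau> (Suc N) c" q s "Suc n" "Suc N"]]
    by (auto simp: tau_comp_Suc in_set_conv_decomp[of b] sublist_def)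
  ultimately have "b \<in> set (h (Suc n) (Suc (Suc N)) [c])" by blast
  then have "sublist [b] (h (Suc n) (Suc (Suc N)) [c])"
    by (auto simp: in_set_conv_decomp sublist_def)
  then show ?thesis using c N(2) unfolding language_def
    by (intro CollectI exI[of _ "Suc (Suc N)"]) auto
qed

lemma language_desubst:
  assumes "u \<in> language n"
  shows "\<exists>v\<in>language (Suc n). sublist u (subst_word (\<tau> n) v)"
proof -
  obtain N b where N: "N > n" "b \<in> A N" "sublist u (h n N [b])"
    using assms by (auto simp: language_def)
  then have "sublist u (subst_word (\<tau> n) (h (Suc n) N [b]))" by (simp add: tau_comp_Cons)
  moreover have "h (Suc n) N [b] \<in> language (Suc n)"
  proof (cases "N = Suc n")
    \<comment> \<open>No morphism remains after removing \<tau>_n: the word is the single letter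
      \<open>b\<close>.\<close>
    case True
    then show ?thesis using N singleton_language by simp
  next
    case False
    then show ?thesis using N by (auto simp: language_def intro!: exI[of _ N])
  qed
  ultimately show ?thesis by blast
qed

section \<open>Desubstitution at positive levels, where the morphisms have constant length\<close>

lemma length_tau_Suc: "length (\<tau> (Suc m) a) = Suc (q m)"
  using q_ge[of m] by (simp add: tau_def)

text \<open>Position \<open>q m - 1\<close> alone carries the argument, counting from 0. Together
  with constant length, this drives desubstitution and recognizability at positive levels.\<close>

lemma tau_Suc_nth:
  "\<tau> (Suc m) a ! (q m - 1) = a"
  "j < Suc (q m) \<Longrightarrow> j \<noteq> q m - 1 \<Longrightarrow> \<tau> (Suc m) a ! j = \<tau> (Suc m) a' ! j"
  using q_ge[of m] by (auto simp: tau_def nth_append nth_Cons split: nat.split)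

text \<open>Constant length puts the cut points at the multiples of \<open>Suc (q m)\<close>, so
  division with remainder locates a position in its block.\<close>

lemma cuts_tau_Suc:
  assumes "\<And>k. x k = \<tau> (Suc m) (y (k div int (Suc (q m)))) ! nat (k mod int (Suc (q m)))"
  shows "cuts (\<tau> (Suc m)) y x (\<lambda>i. int (Suc (q m)) * i)"
  using assms by (simp add: cuts_def length_tau_Suc algebra_simps del: of_nat_Suc)

lemma subst_seq_tau_Suc:
  "subst_seq (subst_word (\<tau> (Suc m))) y k =
     \<tau> (Suc m) (y (k div int (Suc (q m)))) ! nat (k mod int (Suc (q m)))"
  using subst_seq_eqI[OF cuts_tau_Suc[where y = y and m = m, OF refl]] by simp

lemma subst_word_tau_Suc_nth:
  assumes "k < Suc (q m) * length v"
  shows "subst_word (\<tau> (Suc m)) v ! k = \<tau> (Suc m) (v ! (k div Suc (q m))) ! (k mod Suc (q m))"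
  using assms
proof (induction v arbitrary: k)
  case (Cons a v)
  show ?case
  proof (cases "k < Suc (q m)")
    case True
    then show ?thesis by (simp add: nth_append length_tau_Suc)
  next
    case False
    then have "k - Suc (q m) < Suc (q m) * length v" using Cons.prems by simp
    moreover have "k div Suc (q m) = Suc ((k - Suc (q m)) div Suc (q m))"
      "k mod Suc (q m) = (k - Suc (q m)) mod Suc (q m)"
      using False by (simp_all add: le_div_geq le_mod_geq del: mult_Suc)
    ultimately show ?thesis using False Cons.IH[of "k - Suc (q m)"]
      by (simp add: nth_append length_tau_Suc)
  qed
qed simp

lemma length_subst_word_tau_Suc: "length (subst_word (\<tau> (Suc m)) v) = Suc (q m) * length v"
  by (induction v) (simp_all add: length_tau_Suc)

text \<open>Every central window of \<open>x\<close> lies in the image of a word, with some residue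
  of the origin modulo the block length. Pigeonhole fixes one residue for all windows; then
  \<open>y\<close> is read off at the argument positions.\<close>

lemma desubst_Suc:
  assumes x: "x \<in> X (Suc m)"
  shows "\<exists>y\<in>X (Suc (Suc m)). \<exists>j<length (\<tau> (Suc m) (y 0)).
    x = (shift ^^ j) (subst_seq (subst_word (\<tau> (Suc m))) y)"
proof -
  define p where "p = int (Suc (q m))"
  have p: "p > 0" by (simp add: p_def)
  \<comment> \<open>\<open>Q j l\<close> says that the window of radius \<open>l\<close> around 0
    lies in the image of a word \<open>v\<close> of the next language, with the origin at a place
    \<open>o'\<close> of residue \<open>j\<close>.\<close>
  define Q where "Q j l \<longleftrightarrow> (\<exists>v o'. v \<in> language (Suc (Suc m)) \<and> o' mod p = j \<and>
    (\<forall>i. \<bar>i\<bar> \<le> l \<longrightarrow> 0 \<le> i + o' \<and> i + o' < p * int (length v) \<and>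
       x i = \<tau> (Suc m) (v ! nat ((i + o') div p)) ! nat ((i + o') mod p)))" for j l
  have Q_ex: "\<exists>j\<in>{0..<p}. Q j l" for l
  proof -
    have "map x [-l..l] \<in> language (Suc m)" using x by (simp add: mem_level_subshift_iff)
    then obtain v where v: "v \<in> language (Suc (Suc m))" "sublist (map x [-l..l]) (subst_word (\<tau> (Suc m)) v)"
      using language_desubst by blast
    then obtain ps ss where ps: "subst_word (\<tau> (Suc m)) v = ps @ map x [-l..l] @ ss"
      by (auto simp: sublist_def)
    define o' where "o' = int (length ps) + l"
    have "0 \<le> i + o' \<and> i + o' < p * int (length v) \<and>
       x i = \<tau> (Suc m) (v ! nat ((i + o') div p)) ! nat ((i + o') mod p)" if i: "\<bar>i\<bar> \<le> l" for i
    proof -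
      let ?k = "length ps + nat (i + l)"
      have k: "int ?k = i + o'" using i by (simp add: o'_def)
      have "nat (i + l) < nat (2 * l + 1)" using i by auto
      then have "?k < length (subst_word (\<tau> (Suc m)) v)" using i by (simp add: ps)
      then have lt: "?k < Suc (q m) * length v" by (simp add: length_subst_word_tau_Suc)
      have "- l \<le> i" "i \<le> l" using i by auto
      then have "x i = subst_word (\<tau> (Suc m)) v ! ?k" by (simp add: ps nth_append)
      also have "\<dots> = \<tau> (Suc m) (v ! (?k div Suc (q m))) ! (?k mod Suc (q m))"
        by (rule subst_word_tau_Suc_nth[OF lt])
      also have "?k div Suc (q m) = nat ((i + o') div p)"
        unfolding k[symmetric] p_def by (metis nat_int zdiv_int)
      also have "?k mod Suc (q m) = nat ((i + o') mod p)"
        unfolding k[symmetric] p_def by (metis nat_int zmod_int)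
      finally have "x i = \<tau> (Suc m) (v ! nat ((i + o') div p)) ! nat ((i + o') mod p)" .
      moreover have "i + o' < p * int (length v)"
        unfolding k[symmetric] p_def using lt by (metis of_nat_less_iff of_nat_mult)
      moreover have "0 \<le> i + o'" unfolding k[symmetric] by simp
      ultimately show ?thesis by blast
    qed
    then have "Q (o' mod p) l" using v(1) unfolding Q_def by blast
    then show ?thesis using p by (intro bexI[of _ "o' mod p"]) auto
  qed
  have Q_mono: "Q j l" if "Q j l'" "l \<le> l'" for j l l'
    using that unfolding Q_def by (metis order.trans)
  text \<open>Some residue is compatible with arbitrarily long central factors, hence with all of them.\<close>
  have "\<exists>j\<in>{0..<p}. \<forall>l. Q j l"
  proof (rule ccontr)
    assume "\<not> ?thesis"
    then have "\<forall>j\<in>{0..<p}. \<exists>l. \<not> Q j l" by blast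
    then obtain L where L: "\<forall>j\<in>{0..<p}. \<not> Q j (L j)" by metis
    obtain j where j: "j \<in> {0..<p}" "Q j (Max (L ` {0..<p}))" using Q_ex by blast
    then have "L j \<le> Max (L ` {0..<p})" by simp
    then show False using Q_mono[OF j(2)] L j(1) by blast
  qed
  then obtain j where j: "0 \<le> j" "j < p" "\<And>l. Q j l" by auto
  \<comment> \<open>The argument position of block \<open>i\<close>, for blocks whose origin lies at
    \<open>- j\<close>.\<close>
  define y where "y i = x (p * i + (int (q m) - 1) - j)" for i
  have xy: "x i = \<tau> (Suc m) (y ((i + j) div p)) ! nat ((i + j) mod p)" for i
  proof (cases "(i + j) mod p = int (q m) - 1")
    case True
    have "p * ((i + j) div p) + (i + j) mod p = i + j" by simp
    then have "y ((i + j) div p) = x i" using True by (simp add: y_def)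
    moreover have "nat ((i + j) mod p) = q m - 1" using True by simp
    ultimately show ?thesis using tau_Suc_nth(1)[of m "x i"] by simp
  next
    case False
    \<comment> \<open>Away from argument positions the letter depends only on the residue, so any
      compatible \<open>v\<close> predicts it, and \<open>y\<close> predicts the same
      letter.\<close>
    obtain v o' where o': "o' mod p = j"
      "x i = \<tau> (Suc m) (v ! nat ((i + o') div p)) ! nat ((i + o') mod p)"
      using j(3)[of "\<bar>i\<bar>"] unfolding Q_def by blast
    have "(i + o') mod p = (i + j) mod p" using o'(1) by (metis mod_add_right_eq)
    moreover have "nat ((i + j) mod p) < Suc (q m)" using p by (auto simp: p_def nat_less_iff)
    moreover have "nat ((i + j) mod p) \<noteq> q m - 1" using False p q_ge[of m] by auto
    ultimately show ?thesis using o'(2) tau_Suc_nth(2) by metis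
  qed
  have "y \<in> X (Suc (Suc m))"
    unfolding mem_level_subshift_iff
  proof (intro allI)
    fix a b :: int
    \<comment> \<open>The radius takes in every position from which \<open>y\<close> reads a letter
      with index in \<open>[a..b]\<close>: the term \<open>p * i\<close> is bounded by the first two
      summands, and the remaining displacement is below \<open>2 * p\<close>.\<close>
    define l where "l = \<bar>p * a\<bar> + \<bar>p * b\<bar> + 2 * p"
    obtain v o' where v: "v \<in> language (Suc (Suc m))" "o' mod p = j"
      and o': "\<And>i. \<bar>i\<bar> \<le> l \<Longrightarrow> 0 \<le> i + o' \<and> i + o' < p * int (length v) \<and>
        x i = \<tau> (Suc m) (v ! nat ((i + o') div p)) ! nat ((i + o') mod p)"
      using j(3)[of l] unfolding Q_def by blast
    define t where "t = o' div p"
    have ot: "o' = p * t + j" unfolding t_def v(2)[symmetric] by simp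
    have y: "0 \<le> i + t \<and> i + t < int (length v) \<and> y i = v ! nat (i + t)" if i: "a \<le> i" "i \<le> b" for i
    proof -
      let ?i = "p * i + (int (q m) - 1) - j"
      have "p * a \<le> p * i" "p * i \<le> p * b" using i p by auto
      moreover have "0 \<le> int (q m) - 1" "int (q m) - 1 < p" using q_ge[of m] by (auto simp: p_def)
      ultimately have "\<bar>?i\<bar> \<le> l" using j(1,2) unfolding l_def by linarith
      note o'[OF this]
      moreover have e: "?i + o' = (int (q m) - 1) + p * (i + t)" by (simp add: ot algebra_simps)
      moreover have "((int (q m) - 1) + p * (i + t)) div p = i + t"
        "((int (q m) - 1) + p * (i + t)) mod p = int (q m) - 1"
        using \<open>0 \<le> int (q m) - 1\<close> \<open>int (q m) - 1 < p\<close> by simp_all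
      moreover have "nat (int (q m) - 1) = q m - 1" by simp
      ultimately have *: "0 \<le> (int (q m) - 1) + p * (i + t)"
        "(int (q m) - 1) + p * (i + t) < p * int (length v)" "x ?i = v ! nat (i + t)"
        by (simp_all only: tau_Suc_nth)
      have "0 \<le> i + t"
        using *(1) \<open>((int (q m) - 1) + p * (i + t)) div p = i + t\<close> p
        by (metis pos_imp_zdiv_nonneg_iff)
      moreover have "p * (i + t) < p * int (length v)" using *(2) \<open>0 \<le> int (q m) - 1\<close> by linarith
      then have "i + t < int (length v)" using p by simp
      ultimately show ?thesis using *(3) by (simp add: y_def)
    qed
    show "map y [a..b] \<in> language (Suc (Suc m))"
    proof (cases "a \<le> b")
      case True
      have "map y [a..b] = take (nat (b - a + 1)) (drop (nat (a + t)) v)"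
      proof (rule nth_equalityI)
        have "nat (b - a + 1) \<le> length v - nat (a + t)" using y[of b] y[of a] True by auto
        then show len: "length (map y [a..b]) = length (take (nat (b - a + 1)) (drop (nat (a + t)) v))"
          by simp
        fix k
        assume "k < length (map y [a..b])"
        then have k: "k < nat (b - a + 1)" by simp
        then have "y (a + int k) = v ! nat (a + int k + t)" using y[of "a + int k"] by auto
        moreover have "nat (a + int k + t) = nat (a + t) + k" using y[of a] True by auto
        moreover have "nat (a + t) \<le> length v" using y[of a] True by auto
        ultimately show "map y [a..b] ! k = take (nat (b - a + 1)) (drop (nat (a + t)) v) ! k"
          using k by simp
      qed
      then have "sublist (map y [a..b]) v"
        by (metis sublist_drop sublist_order.order_trans sublist_take)
      then show ?thesis using v(1) sublist_language by blast
    next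
      case False
      then show ?thesis using v(1) sublist_language by auto
    qed
  qed
  moreover have "nat j < length (\<tau> (Suc m) (y 0))"
    using j(1,2) by (auto simp: length_tau_Suc p_def)
  moreover have "x = (shift ^^ nat j) (subst_seq (subst_word (\<tau> (Suc m))) y)"
    unfolding fun_eq_iff shift_funpow subst_seq_tau_Suc p_def[symmetric]
    using xy j(1) by simp
  ultimately show ?thesis by blast
qed

section \<open>Desubstitution at level 0, decoding from the zeros\<close>

lemma tau_0: "\<tau> 0 a = 0 # replicate a 1"
  by (simp add: tau_def)

lemma subst_word_tau_0_Cons [simp]:
  "subst_word (\<tau> 0) (a # u) = 0 # replicate a 1 @ subst_word (\<tau> 0) u"
  by (simp add: tau_0)

declare subst_word_simps(2) [simp del]

lemma subst_word_tau_0_head: "subst_word (\<tau> 0) v = [] \<or> hd (subst_word (\<tau> 0) v) = 0"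
  by (cases v) simp_all

text \<open>The zero after the ones ends the run, and \<open>r\<close> cannot prolong the run on the
  other side, so the two run lengths agree.\<close>

lemma prefix_replicate_one:
  "prefix (replicate a (1::nat) @ 0 # w) (replicate b 1 @ r) \<Longrightarrow> r = [] \<or> hd r = 0 \<Longrightarrow>
     a = b \<and> prefix (0 # w) r"
proof (induction a arbitrary: b)
  case 0
  then show ?case by (cases b) auto
next
  case (Suc a)
  then show ?case by (cases b; cases r) auto
qed

text \<open>The appended 0 closes the last block; without it, the last letter of \<open>u\<close>
  could be smaller than the corresponding letter of \<open>v\<close>.\<close>

lemma prefix_subst_word_tau_0:
  "prefix (subst_word (\<tau> 0) u @ [0]) (subst_word (\<tau> 0) v) \<Longrightarrow> prefix u v"
proof (induction u arbitrary: v)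
  case (Cons a u)
  obtain b v' where v: "v = b # v'" using Cons.prems by (cases v) auto
  obtain w where w: "subst_word (\<tau> 0) u @ [0] = 0 # w" by (cases u) auto
  have "prefix (replicate a 1 @ 0 # w) (replicate b 1 @ subst_word (\<tau> 0) v')"
    using Cons.prems w by (simp add: v)
  from prefix_replicate_one[OF this subst_word_tau_0_head] w Cons.IH show ?case
    by (simp add: v)
qed simp

text \<open>The occurrence starts with 0, hence at the start of a block, which reduces to the prefix
  case.\<close>

lemma sublist_subst_word_tau_0:
  "sublist (subst_word (\<tau> 0) u @ [0]) (subst_word (\<tau> 0) v) \<Longrightarrow> sublist u v"
proof (induction v)
  case (Cons b v)
  obtain w where w: "subst_word (\<tau> 0) u @ [0] = 0 # w" by (cases u) auto
  have *: "sublist (0 # w) (replicate k 1 @ r) \<Longrightarrow> sublist (0 # w) r" for k r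
    by (induction k) (auto simp: sublist_Cons_right)
  consider "prefix (subst_word (\<tau> 0) u @ [0]) (subst_word (\<tau> 0) (b # v))"
    | "sublist (0 # w) (replicate b 1 @ subst_word (\<tau> 0) v)"
    using Cons.prems by (auto simp: w sublist_Cons_right)
  then show ?case
  proof cases
    case 1
    then show ?thesis using prefix_subst_word_tau_0 by blast
  next
    case 2
    then show ?thesis using * Cons.IH w by (auto simp: sublist_Cons_right)
  qed
qed simp

text \<open>Every block starts with 0, so a run of ones stays inside one block and is no longer than
  its letter.\<close>

lemma run_length_bound:
  "sublist (replicate k 1) (subst_word (\<tau> 0) v) \<Longrightarrow> \<forall>a\<in>set v. a \<le> B \<Longrightarrow> k \<le> B"
proof (induction v)
  case (Cons b v)
  then have "k = 0 \<or> sublist (replicate k 1) (replicate b 1 @ subst_word (\<tau> 0) v)"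
    by (cases k) (auto simp: sublist_Cons_right)
  moreover have "k \<le> b" if "xs @ ys = replicate k 1" "suffix xs (replicate b 1)"
    "prefix ys (subst_word (\<tau> 0) v)" for xs ys
  proof -
    have "ys = []"
    proof (rule ccontr)
      assume "ys \<noteq> []"
      then have "hd ys \<in> set (replicate k 1)" by (metis that(1) hd_in_set UnCI set_append)
      moreover have "hd ys = 0"
        using \<open>ys \<noteq> []\<close> that(3) subst_word_tau_0_head[of v] by (auto elim!: prefixE)
      ultimately show False by simp
    qed
    then show ?thesis using that suffix_length_le by fastforce
  qed
  moreover have "k \<le> b" if "sublist (replicate k 1) (replicate b (1::nat))"
    using sublist_length_le[OF that] by simp
  ultimately have "k = 0 \<or> k \<le> b \<or> sublist (replicate k 1) (subst_word (\<tau> 0) v)"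
    by (auto simp: sublist_append)
  then show ?case using Cons by auto
qed simp

text \<open>Bounded spacers bound the runs of ones, so zeros occur with bounded gaps, in particular
  arbitrarily far in both directions.\<close>

lemma zero_gap: "\<exists>B. \<forall>x\<in>X 0. \<forall>i. \<exists>k\<le>B. x (i + int k) = 0"
proof -
  obtain B where B: "\<forall>a\<in>A 1. a \<le> B" using alphabet_bounded by auto
  have "\<exists>k\<le>B. x (i + int k) = 0" if x: "x \<in> X 0" for x i
  proof (rule ccontr)
    assume *: "\<not> ?thesis"
    have "x j = 1" if "i \<le> j" "j \<le> i + int B" for j
    proof -
      have "x j \<in> {0, 1}" using letter_in_alphabet[OF x] by (simp add: alphabet_def)
      moreover have "j = i + int (nat (j - i))" "nat (j - i) \<le> B" using that by auto
      then have "x j \<noteq> 0" using * by metis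
      ultimately show ?thesis by auto
    qed
    then have "map x [i..i + int B] = replicate (Suc B) 1"
      by (intro nth_equalityI) (auto simp del: replicate_Suc)
    moreover obtain v where v: "v \<in> language 1" "sublist (map x [i..i + int B]) (subst_word (\<tau> 0) v)"
      using language_desubst[of "map x [i..i + int B]" 0] x by (auto simp: mem_level_subshift_iff)
    ultimately have "Suc B \<le> B"
      using run_length_bound[of "Suc B" v B] set_language[OF v(1)] B by auto
    then show False by simp
  qed
  then show ?thesis by blast
qed

declare subst_word_simps(2) [simp]

text \<open>The zeros of \<open>x\<close> serve as cut points, and the number of ones between
  consecutive zeros is the letter of \<open>y\<close>.\<close>

lemma desubst_0:
  assumes x: "x \<in> X 0"
  shows "\<exists>y\<in>X 1. \<exists>j<length (\<tau> 0 (y 0)). x = (shift ^^ j) (subst_seq (subst_word (\<tau> 0)) y)"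
proof -
  obtain B where "\<forall>x\<in>X 0. \<forall>i. \<exists>k\<le>B. x (i + int k) = 0" using zero_gap by blast
  then have gap: "\<exists>k\<le>B. x (i + int k) = 0" for i using x by blast
  have x01: "x i = 0 \<or> x i = 1" for i
    using letter_in_alphabet[OF x, of i] by (auto simp: alphabet_def)
  have "\<exists>u>w. x u = 0 \<and> (\<forall>i. w < i \<longrightarrow> i < u \<longrightarrow> x i \<noteq> 0)" for w
  proof -
    let ?Q = "\<lambda>k. x (w + 1 + int k) = 0"
    have Q: "?Q (LEAST k. ?Q k)" using gap[of "w + 1"] by (auto intro: LeastI)
    show ?thesis
    proof (intro exI[of _ "w + 1 + int (LEAST k. ?Q k)"] conjI allI impI)
      fix i assume "w < i" "i < w + 1 + int (LEAST k. ?Q k)"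
      then have "nat (i - w - 1) < (LEAST k. ?Q k)" and i: "w + 1 + int (nat (i - w - 1)) = i" by auto
      from not_less_Least[OF this(1)] show "x i \<noteq> 0" unfolding i .
    qed (use Q in auto)
  qed
  then obtain up where up: "\<And>w. up w > w" "\<And>w. x (up w) = 0"
    "\<And>w i. w < i \<Longrightarrow> i < up w \<Longrightarrow> x i \<noteq> 0" by metis
  have "\<exists>u<w. x u = 0 \<and> (\<forall>i. u < i \<longrightarrow> i < w \<longrightarrow> x i \<noteq> 0)" for w
  proof -
    let ?Q = "\<lambda>k. x (w - 1 - int k) = 0"
    \<comment> \<open>A zero among the \<open>B + 1\<close> positions before \<open>w\<close>, found
      by searching rightwards from the leftmost of them.\<close>
    obtain k where k: "k \<le> B" "x (w - 1 - int B + int k) = 0" using gap by blast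
    then have "?Q (B - k)" by (simp add: of_nat_diff algebra_simps)
    then have Q: "?Q (LEAST k. ?Q k)" by (rule LeastI)
    show ?thesis
    proof (intro exI[of _ "w - 1 - int (LEAST k. ?Q k)"] conjI allI impI)
      fix i assume "w - 1 - int (LEAST k. ?Q k) < i" "i < w"
      then have "nat (w - 1 - i) < (LEAST k. ?Q k)" and i: "w - 1 - int (nat (w - 1 - i)) = i" by auto
      from not_less_Least[OF this(1)] show "x i \<noteq> 0" unfolding i .
    qed (use Q in auto)
  qed
  then obtain dn where dn: "\<And>w. dn w < w" "\<And>w. x (dn w) = 0"
    "\<And>w i. dn w < i \<Longrightarrow> i < w \<Longrightarrow> x i \<noteq> 0" by metis
  have up_dn: "up (dn w) = w" if "x w = 0" for w
  proof (rule linorder_cases[of "up (dn w)" w])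
    assume "up (dn w) < w"
    then show ?thesis using up(1,2)[of "dn w"] dn(3)[of w "up (dn w)"] by simp
  next
    assume "w < up (dn w)"
    then show ?thesis using up(3)[of "dn w" w] dn(1)[of w] that by simp
  qed
  \<comment> \<open>The last zero at a position at most 0. Its block contains the origin and becomes
    block 0, so the shift amount is \<open>- z\<close>.\<close>
  define z where "z = dn 1"
  define P where "P i = (if 0 \<le> i then (up ^^ nat i) z else (dn ^^ nat (- i)) z)" for i
  have zero: "x ((f ^^ k) z) = 0" if "\<And>w. x (f w) = 0" for f k
    using that dn(2) by (cases k) (auto simp: z_def)
  have P0: "x (P i) = 0" for i using zero up(2) dn(2) by (simp add: P_def)
  have P_Suc: "P (i + 1) = up (P i)" for i
  proof (cases "0 \<le> i")
    case True
    then show ?thesis by (simp add: P_def nat_add_distrib)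
  next
    case False
    then have "nat (- i) = Suc (nat (- (i + 1)))" by simp
    then have "P i = dn (P (i + 1))" using False by (simp add: P_def)
    then show ?thesis using up_dn P0 by simp
  qed
  define y where "y i = nat (P (i + 1) - P i - 1)" for i
  have yP: "P (i + 1) = P i + 1 + int (y i)" for i using up(1)[of "P i"] by (simp add: y_def P_Suc)
  define x' where "x' i = x (i + z)" for i
  have "P 0 = z" by (simp add: P_def)
  have cuts: "cuts (\<tau> 0) y x' (\<lambda>i. P i - z)"
    unfolding cuts_def
  proof (intro conjI allI impI)
    fix i j
    assume j: "j < length (\<tau> 0 (y i))"
    show "x' (P i - z + int j) = \<tau> 0 (y i) ! j"
    proof (cases j)
      case 0
      then show ?thesis using P0 by (simp add: x'_def tau_0)
    next
      case (Suc k)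
      then have "x (P i + int j) \<noteq> 0" using yP[of i] j by (intro up(3)[of "P i"]) (auto simp: tau_0 simp flip: P_Suc)
      then show ?thesis using x01[of "P i + int j"] Suc j by (simp add: x'_def tau_0 algebra_simps)
    qed
  qed (use \<open>P 0 = z\<close> yP in \<open>simp_all add: tau_0\<close>)
  have "z \<le> 0" using dn(1)[of 1] by (simp add: z_def)
  have "up z = P 1" using P_Suc[of 0] \<open>P 0 = z\<close> by simp
  have "P 1 \<ge> 1"
  proof (rule ccontr)
    assume "\<not> ?thesis"
    then show False using dn(3)[of 1 "P 1"] up(1)[of z] P0[of 1] \<open>up z = P 1\<close> by (simp add: z_def)
  qed
  then have j: "nat (- z) < length (\<tau> 0 (y 0))" using yP[of 0] \<open>P 0 = z\<close> by (simp add: tau_0)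
  have "x = (shift ^^ nat (- z)) x'" using \<open>z \<le> 0\<close> by (auto simp: shift_funpow x'_def)
  moreover have x': "subst_seq (subst_word (\<tau> 0)) y = x'" using subst_seq_eqI[OF cuts] by simp
  moreover have "y \<in> X 1"
    unfolding mem_level_subshift_iff
  proof (intro allI)
    fix a b :: int
    \<comment> \<open>The maximum keeps \<open>a \<le> c\<close> when the window is empty.\<close>
    define c where "c = max (b + 1) a"
    have "a \<le> c" by (simp add: c_def)
    have ne: "\<And>a. \<tau> 0 a \<noteq> []" by simp
    have "P a \<le> P c" using cuts_mono[OF cuts ne \<open>a \<le> c\<close>] \<open>a \<le> c\<close> by linarith
    \<comment> \<open>The zero at \<open>P c\<close> is kept to close the last block, as the
      decoding lemma requires.\<close>
    have "map x [P a..P c] = map x [P a..P c - 1] @ [0]"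
      using \<open>P a \<le> P c\<close> P0 by (simp add: upto_rec2)
    also have "map x [P a..P c - 1] = map x' [P a - z..P c - z - 1]"
      by (rule nth_equalityI) (auto simp: x'_def)
    also have "\<dots> = subst_word (\<tau> 0) (map y [a..c - 1])"
      by (rule cuts_word[OF cuts ne \<open>a \<le> c\<close>])
    finally have "subst_word (\<tau> 0) (map y [a..c - 1]) @ [0] \<in> language 0"
      using x by (metis mem_level_subshift_iff)
    then obtain v where v: "v \<in> language 1"
      "sublist (subst_word (\<tau> 0) (map y [a..c - 1]) @ [0]) (subst_word (\<tau> 0) v)"
      using language_desubst by force
    then have "map y [a..c - 1] \<in> language 1" using sublist_subst_word_tau_0 sublist_language by blast
    moreover have "[a..c - 1] = [a..b]" by (auto simp: c_def max_def)
    ultimately show "map y [a..b] \<in> language 1" by simp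
  qed
  ultimately show ?thesis using j by blast
qed

section \<open>Recognizability: uniqueness of desubstitution\<close>

lemma recognizable_0:
  assumes "j < length (\<tau> 0 (y 0))" "j' < length (\<tau> 0 (y' 0))"
    and eq: "(shift ^^ j) (subst_seq (subst_word (\<tau> 0)) y) = (shift ^^ j') (subst_seq (subst_word (\<tau> 0)) y')"
  shows "j = j' \<and> y = y'"
proof -
  let ?z = "subst_seq (subst_word (\<tau> 0))"
  \<comment> \<open>The zeros of an image under \<tau>_0 are exactly its cut points.\<close>
  have cuts: "\<exists>P. P 0 = 0 \<and> (\<forall>i. P (i + 1) = P i + 1 + int (y i)) \<and> (\<forall>i. ?z y (P i) = 0) \<and>
    (\<forall>i k. P i < k \<longrightarrow> k < P (i + 1) \<longrightarrow> ?z y k \<noteq> 0)" for y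
  proof -
    obtain P where P: "cuts (\<tau> 0) y (?z y) P" using cuts_exists[of "\<tau> 0" y] by auto
    then have P1: "P 0 = 0" "\<And>i. P (i + 1) = P i + 1 + int (y i)"
      "\<And>i k. k < Suc (y i) \<Longrightarrow> ?z y (P i + int k) = \<tau> 0 (y i) ! k"
      by (auto simp: cuts_def tau_0)
    have "?z y k \<noteq> 0" if "P i < k" "k < P (i + 1)" for i k
    proof -
      have "nat (k - P i) < Suc (y i)" "P i + int (nat (k - P i)) = k" "nat (k - P i) \<noteq> 0"
        using that P1(2)[of i] by auto
      then show ?thesis using P1(3)[of "nat (k - P i)" i] by (simp add: tau_0 nth_Cons')
    qed
    moreover have "?z y (P i) = 0" for i using P1(3)[of 0 i] by (simp add: tau_0)
    ultimately show ?thesis using P1(1,2) by blast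
  qed
  obtain P where P: "P 0 = 0" "\<And>i. P (i + 1) = P i + 1 + int (y i)" "\<And>i. ?z y (P i) = 0"
    "\<And>i k. P i < k \<Longrightarrow> k < P (i + 1) \<Longrightarrow> ?z y k \<noteq> 0" using cuts[of y] by blast
  obtain P' where P': "P' 0 = 0" "\<And>i. P' (i + 1) = P' i + 1 + int (y' i)" "\<And>i. ?z y' (P' i) = 0"
    "\<And>i k. P' i < k \<Longrightarrow> k < P' (i + 1) \<Longrightarrow> ?z y' k \<noteq> 0" using cuts[of y'] by blast
  have e: "?z y (k + int j) = ?z y' (k + int j')" for k
    using fun_cong[OF eq, of k] by (simp add: shift_funpow)
  have "\<not> j < j'"
  proof
    assume "j < j'"
    \<comment> \<open>Cut point 0 of \<open>y\<close> falls strictly inside block 0 of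
      \<open>y'\<close>, where no zero can stand.\<close>
    then have "?z y' (int j' - int j) \<noteq> 0" using assms(2) P'(1) P'(2)[of 0] by (intro P'(4)[of 0]) (auto simp: tau_0)
    then show False using e[of "- int j"] P(1) P(3)[of 0] by simp
  qed
  moreover have "\<not> j' < j"
  proof
    assume "j' < j"
    then have "?z y (int j - int j') \<noteq> 0" using assms(1) P(1) P(2)[of 0] by (intro P(4)[of 0]) (auto simp: tau_0)
    then show False using e[of "- int j'"] P'(1) P'(3)[of 0] by simp
  qed
  ultimately have "j = j'" by simp
  then have z: "?z y k = ?z y' k" for k using e[of "k - int j"] by simp
  \<comment> \<open>Consecutive zeros after and before a common cut point coincide, so all cut
    points agree by induction in both directions.\<close>
  have up: "P (i + 1) = P' (i + 1)" if "P i = P' i" for i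
  proof -
    have "P i < P (i + 1)" "P' i < P' (i + 1)" using P(2)[of i] P'(2)[of i] by simp_all
    then have "\<not> P (i + 1) < P' (i + 1)" "\<not> P' (i + 1) < P (i + 1)"
      using P(3)[of "i + 1"] P'(3)[of "i + 1"] P(4)[of i "P' (i + 1)"] P'(4)[of i "P (i + 1)"]
        that z by (metis, metis)
    then show ?thesis by simp
  qed
  have dn: "P (i - 1) = P' (i - 1)" if "P i = P' i" for i
  proof -
    have "P (i - 1) < P i" "P' (i - 1) < P' i" using P(2)[of "i - 1"] P'(2)[of "i - 1"] by simp_all
    moreover have "i - 1 + 1 = i" by simp
    ultimately have "\<not> P (i - 1) < P' (i - 1)" "\<not> P' (i - 1) < P (i - 1)"
      using P(3)[of "i - 1"] P'(3)[of "i - 1"] P(4)[of "i - 1" "P' (i - 1)"]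
        P'(4)[of "i - 1" "P (i - 1)"] that z by (metis, metis)
    then show ?thesis by simp
  qed
  have "P i = P' i" for i
    by (induction i rule: int_induct[where k = 0]) (auto simp: P(1) P'(1) up dn)
  then have "y i = y' i" for i using P(2)[of i] P'(2)[of i] by simp
  then show ?thesis using \<open>j = j'\<close> by auto
qed

text \<open>If the offsets differ, each position is a non-argument position in at least one of the
  two parsings, and its letter then recurs one block length later. This makes \<open>x\<close>
  periodic. With equal offsets the argument positions recover \<open>y\<close> and
  \<open>y'\<close>.\<close>

lemma recognizable_Suc:
  assumes "j < Suc (q m)" "j' < Suc (q m)"
    and "x = (shift ^^ j) (subst_seq (subst_word (\<tau> (Suc m))) y)"
    and "x = (shift ^^ j') (subst_seq (subst_word (\<tau> (Suc m))) y')"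
    and "(shift ^^ Suc (q m)) x \<noteq> x"
  shows "j = j' \<and> y = y'"
proof -
  define p where "p = int (Suc (q m))"
  have p: "p > 0" by (simp add: p_def)
  have x: "x i = \<tau> (Suc m) (y ((i + int j) div p)) ! nat ((i + int j) mod p)"
    "x i = \<tau> (Suc m) (y' ((i + int j') div p)) ! nat ((i + int j') mod p)" for i
    using fun_cong[OF assms(3), of i] fun_cong[OF assms(4), of i]
    by (simp_all add: shift_funpow subst_seq_tau_Suc p_def)
  have nat_less: "nat (i mod p) < Suc (q m)" for i using p by (auto simp: p_def nat_less_iff)
  have nat_eq: "i mod p = int (q m) - 1" if "nat (i mod p) = q m - 1" for i
    using that p q_ge[of m] by (auto simp: nat_eq_iff)
  have "j = j'"
  proof (rule ccontr)
    assume "j \<noteq> j'"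
    have "x (i + p) = x i" for i
    proof -
      have e: "(i + p + c) mod p = (i + c) mod p" for c
        by (metis add.assoc add.commute mod_add_self2)
      have "(i + int j) mod p \<noteq> (i + int j') mod p"
      proof
        assume "(i + int j) mod p = (i + int j') mod p"
        then have "int j mod p = int j' mod p" by (metis add_diff_cancel_left' mod_diff_left_eq)
        then show False using \<open>j \<noteq> j'\<close> assms(1,2) by (simp add: p_def)
      qed
      then consider "nat ((i + int j) mod p) \<noteq> q m - 1" | "nat ((i + int j') mod p) \<noteq> q m - 1"
        using nat_eq by metis
      then show ?thesis
      proof cases
        case 1
        then show ?thesis using x(1)[of i] x(1)[of "i + p"] tau_Suc_nth(2)[OF nat_less 1] e by metis
      next
        case 2
        then show ?thesis using x(2)[of i] x(2)[of "i + p"] tau_Suc_nth(2)[OF nat_less 2] e by metis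
      qed
    qed
    then have "(shift ^^ Suc (q m)) x = x"
      unfolding p_def by (intro ext) (simp only: shift_funpow)
    with assms(5) show False by simp
  qed
  moreover have "y i = y' i" for i
  proof -
    let ?i = "p * i + (int (q m) - 1) - int j"
    have "?i + int j = (int (q m) - 1) + p * i" by simp
    moreover have "((int (q m) - 1) + p * i) div p = i" "((int (q m) - 1) + p * i) mod p = int (q m) - 1"
      using q_ge[of m] by (simp_all add: p_def)
    moreover have "nat (int (q m) - 1) = q m - 1" by simp
    ultimately show ?thesis
      using x(1)[of ?i] x(2)[of ?i] \<open>j = j'\<close> by (simp only: tau_Suc_nth(1))
  qed
  ultimately show ?thesis by auto
qed

lemma desubst:
  "x \<in> X n \<Longrightarrow> \<exists>y\<in>X (Suc n). \<exists>j<length (\<tau> n (y 0)). x = (shift ^^ j) (subst_seq (subst_word (\<tau> n)) y)"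
  using desubst_0 desubst_Suc by (cases n) auto

section \<open>Bases of the towers\<close>

lemma compact_level_cylinder: "compact {x \<in> X n. x 0 = b}"
proof -
  have "{x \<in> X n. x 0 = b} =
      {x. range x \<subseteq> A n} \<inter> ((\<Inter>i. \<Inter>j. {x. map x [i..j] \<in> language n}) \<inter> {x. x 0 = b})"
    using letter_in_alphabet by (auto simp: mem_level_subshift_iff)
  moreover have "closed {x. map x [i..j] \<in> language n}" for i j
  proof (rule closed_finitely_determined)
    fix x y assume *: "\<And>k. k \<in> {i..j} \<Longrightarrow> x k = y k" "map x [i..j] \<in> language n"
    then have e: "map x [i..j] = map y [i..j]" by auto
    show "map y [i..j] \<in> language n" using *(2) unfolding e .
  qed simp
  moreover have "closed {x :: int \<Rightarrow> nat. x 0 = b}"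
    by (rule closed_finitely_determined[of "{0}"]) auto
  ultimately show ?thesis
    using compact_functions_into_finite[OF finite_alphabet]
    by (auto intro!: compact_Int_closed closed_Int closed_INT)
qed

definition base :: "nat \<Rightarrow> nat \<Rightarrow> (int \<Rightarrow> nat) set" where
  "base n b = subst_seq (h 0 n) ` {x \<in> X n. x 0 = b}"

text \<open>Compactness provides measurability: a base is a continuous image, and continuous images
  of Borel sets need not be Borel.\<close>

lemma compact_base: "compact (base n b)"
  unfolding base_def
  by (rule compact_continuous_image[OF continuous_on_subset[OF continuous_on_subst_seq]])
    (auto intro: compact_level_cylinder)

lemma base_subset: "base n b \<subseteq> X 0"
  by (auto simp: base_def subst_seq_tau_comp_level_subshift)

lemma shift_base_subset: "(shift ^^ k) ` base n b \<subseteq> X 0"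
  using base_subset shift_level_subshift by blast

lemma base_0: "base 0 b = {x \<in> X 0. x 0 = b}"
  by (simp add: base_def)

lemma base_empty: "b \<notin> A n \<Longrightarrow> base n b = {}"
  using letter_in_alphabet by (auto simp: base_def)

lemma subst_seq_tau_comp_shift:
  "subst_seq (h 0 n) ((shift ^^ k) x) = (shift ^^ length (h 0 n (map x [0..int k - 1]))) (subst_seq (h 0 n) x)"
proof (rule tau_comp_morphism[of q s 0 n])
  fix \<sigma>
  assume \<sigma>: "h 0 n = subst_word \<sigma>" "\<And>b. \<sigma> b = h 0 n [b]"
  have "\<sigma> b \<noteq> []" for b by (simp only: \<sigma>(2) tau_comp_nonempty not_False_eq_True)
  then show ?thesis using subst_seq_shift[of \<sigma> k x] by (simp only: \<sigma>(1) not_False_eq_True)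
qed

lemma length_tau_comp_sum: "length (h 0 n u) = (\<Sum>a\<leftarrow>u. length (h 0 n [a]))"
proof (induction u)
  case (Cons a u)
  then show ?case using tau_comp_append[of q s 0 n "[a]" u] by simp
qed simp

text \<open>The height, in the level \<open>Suc n\<close> tower over \<open>c\<close>, at which the
  block of letter \<open>j\<close> of \<tau>_n(c) begins.\<close>

definition offset :: "nat \<Rightarrow> nat \<Rightarrow> nat \<Rightarrow> nat" where
  "offset n c j = length (h 0 n (take j (\<tau> n c)))"

lemma subst_seq_tau_comp_shift_subst_seq:
  assumes "j < length (\<tau> n (y 0))"
  shows "subst_seq (h 0 n) ((shift ^^ j) (subst_seq (subst_word (\<tau> n)) y)) =
    (shift ^^ offset n (y 0) j) (subst_seq (h 0 (Suc n)) y)"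
  using map_subst_seq_prefix[of "\<tau> n" j y] assms
  by (simp add: subst_seq_tau_comp_shift subst_seq_tau_comp_Suc offset_def)

definition occurrences :: "nat \<Rightarrow> nat \<Rightarrow> (nat \<times> nat) set" where
  "occurrences n b = (SIGMA c:A (Suc n). {j. j < length (\<tau> n c) \<and> \<tau> n c ! j = b})"

text \<open>One inclusion desubstitutes a point of X^(n); the other observes that shifting the image
  by \<open>j\<close> brings letter \<open>j\<close> of \<tau>_n(c) to the origin.\<close>

lemma base_decomposition:
  "base n b = (\<Union>(c, j)\<in>occurrences n b. (shift ^^ offset n c j) ` base (Suc n) c)"
proof (intro equalityI subsetI)
  fix z assume "z \<in> base n b"
  then obtain x where x: "z = subst_seq (h 0 n) x" "x \<in> X n" "x 0 = b" by (auto simp: base_def)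
  obtain y j where y: "y \<in> X (Suc n)" "j < length (\<tau> n (y 0))"
    "x = (shift ^^ j) (subst_seq (subst_word (\<tau> n)) y)" using desubst[OF x(2)] by blast
  have "\<tau> n (y 0) ! j = b"
    using x(3) y(2,3) subst_seq_nth[of "\<tau> n" j y] by (simp add: shift_funpow)
  then have "(y 0, j) \<in> occurrences n b" using y letter_in_alphabet by (simp add: occurrences_def)
  moreover have "z = (shift ^^ offset n (y 0) j) (subst_seq (h 0 (Suc n)) y)"
    using x(1) y subst_seq_tau_comp_shift_subst_seq by simp
  moreover have "subst_seq (h 0 (Suc n)) y \<in> base (Suc n) (y 0)" using y(1) by (auto simp: base_def)
  ultimately show "z \<in> (\<Union>(c, j)\<in>occurrences n b. (shift ^^ offset n c j) ` base (Suc n) c)" by blast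
next
  fix z assume "z \<in> (\<Union>(c, j)\<in>occurrences n b. (shift ^^ offset n c j) ` base (Suc n) c)"
  then obtain y j where y: "(y 0, j) \<in> occurrences n b" "y \<in> X (Suc n)"
    "z = (shift ^^ offset n (y 0) j) (subst_seq (h 0 (Suc n)) y)"
    by (auto simp: base_def)
  let ?x = "(shift ^^ j) (subst_seq (subst_word (\<tau> n)) y)"
  have j: "j < length (\<tau> n (y 0))" "\<tau> n (y 0) ! j = b" using y(1) by (auto simp: occurrences_def)
  have "?x \<in> X n" using y(2) subst_seq_level_subshift shift_level_subshift by simp
  moreover have "?x 0 = b" using j subst_seq_nth[of "\<tau> n" j y] by (simp add: shift_funpow)
  moreover have "z = subst_seq (h 0 n) ?x" using y(3) j(1) subst_seq_tau_comp_shift_subst_seq by simp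
  ultimately show "z \<in> base n b" by (auto simp: base_def)
qed

lemma tower_eq: "tower q s n b = (\<Union>k<length (h 0 n [b]). (shift ^^ k) ` base n b)"
  by (simp add: tower_def base_def)

lemma towers_cover: "X 0 \<subseteq> (\<Union>b\<in>A n. tower q s n b)"
proof (induction n)
  case 0
  show ?case
  proof
    fix x assume x: "x \<in> X 0"
    then have "x \<in> (shift ^^ 0) ` base 0 (x 0)" by (simp add: base_0)
    then have "x \<in> tower q s 0 (x 0)" unfolding tower_eq by (intro UN_I[of 0]) simp_all
    then show "x \<in> (\<Union>b\<in>A 0. tower q s 0 b)"
      using letter_in_alphabet[OF x, of 0] by (rule UN_I[rotated])
  qed
next
  case (Suc n)
  show ?case
  proof
    fix w assume "w \<in> X 0"
    then obtain b where "w \<in> tower q s n b" using Suc by blast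
    then obtain k z where z: "z \<in> base n b" "k < length (h 0 n [b])" "w = (shift ^^ k) z"
      unfolding tower_eq by blast
    have "z \<in> (\<Union>(c, j)\<in>occurrences n b. (shift ^^ offset n c j) ` base (Suc n) c)"
      using z(1) by (simp only: base_decomposition[of n b])
    then obtain c j v where v: "(c, j) \<in> occurrences n b" "z = (shift ^^ offset n c j) v" "v \<in> base (Suc n) c"
      by (elim UN_E) (auto split: prod.splits)
    then have c: "c \<in> A (Suc n)" "j < length (\<tau> n c)" "\<tau> n c ! j = b" by (auto simp: occurrences_def)
    \<comment> \<open>Splitting \<tau>_n(c) around the occurrence of \<open>b\<close> shows that the
      level \<open>n\<close> tower, placed at its offset, ends within the tower over
      \<open>c\<close>.\<close>
    have e: "take j (\<tau> n c) @ [b] @ drop (Suc j) (\<tau> n c) = \<tau> n c"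
      using id_take_nth_drop[OF c(2)] unfolding c(3) by (simp only: append_Cons append_Nil)
    have "length (h 0 n (take j (\<tau> n c) @ [b] @ drop (Suc j) (\<tau> n c))) =
        offset n c j + length (h 0 n [b]) + length (h 0 n (drop (Suc j) (\<tau> n c)))"
      unfolding tau_comp_append length_append offset_def by (rule add.assoc[symmetric])
    then have "length (h 0 n (\<tau> n c)) =
        offset n c j + length (h 0 n [b]) + length (h 0 n (drop (Suc j) (\<tau> n c)))"
      unfolding e .
    moreover have "h 0 (Suc n) [c] = h 0 n (\<tau> n c)" by (simp add: tau_comp_Suc)
    ultimately have "k + offset n c j < length (h 0 (Suc n) [c])" using z(2) by simp
    moreover have "w = (shift ^^ (k + offset n c j)) v" using z(3) v(2) by (simp add: funpow_add)
    ultimately have "w \<in> tower q s (Suc n) c" using v(3) unfolding tower_eq by blast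
    then show "w \<in> (\<Union>b\<in>A (Suc n). tower q s (Suc n) b)" using c(1) by blast
  qed
qed

text \<open>Up to order, \<tau>_(m+1)(c) consists of all the spacers a_(m,i) and the argument
  c.\<close>

lemma card_occurrences_Suc:
  "card {j. j < length (\<tau> (Suc m) c) \<and> \<tau> (Suc m) c ! j = b} =
     spacer_count q s (Suc m) b + (if c = b then 1 else 0)"
proof -
  have *: "card {j. j < length (\<tau> (Suc m) c) \<and> \<tau> (Suc m) c ! j = b} =
      length (filter (\<lambda>a. a = b) (\<tau> (Suc m) c))"
    by (simp only: length_filter_conv_card)
  have "[0..<q m] = 0 # [1..<q m]" using q_ge[of m] by (simp add: upt_conv_Cons)
  moreover have "spacer_count q s (Suc m) b = length (filter (\<lambda>a. a = b) (map (s m) [0..<q m]))"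
    unfolding length_filter_conv_card spacer_count_def by (intro arg_cong[of _ _ card]) auto
  ultimately show ?thesis
    unfolding * by (simp add: tau_def)
qed

end

section \<open>Consequences of aperiodicity: unique desubstitution and disjointness\<close>

locale aperiodic_ferenczi = ferenczi +
  fixes \<mu> :: "(int \<Rightarrow> nat) measure"
  assumes aperiodic: "aperiodic (ferenczi_subshift q s)"
    and invariant: "invariant_prob (ferenczi_subshift q s) \<mu>"
begin

sublocale prob_space \<mu>
  using invariant by (simp add: invariant_prob_def)

text \<open>A period of \<open>x\<close> maps to a period of its image in X_W, whose length is that
  of a non-empty image word and hence positive.\<close>

lemma no_period:
  assumes "x \<in> X n" "p > 0"
  shows "(shift ^^ p) x \<noteq> x"
proof
  assume eq: "(shift ^^ p) x = x"
  let ?z = "subst_seq (h 0 n) x" and ?u = "map x [0..int p - 1]"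
  have "(shift ^^ length (h 0 n ?u)) ?z = ?z" using subst_seq_tau_comp_shift[of n p x] eq by simp
  moreover have "h 0 n ?u \<noteq> []"
    using assms(2) length_tau_comp_sum[of n ?u] by (auto simp: upto_rec1)
  moreover have "?z \<in> ferenczi_subshift q s"
    using subst_seq_tau_comp_level_subshift[OF assms(1)] level_subshift_0 by simp
  ultimately show False using aperiodic by (auto simp: aperiodic_def)
qed

lemma recognizable:
  assumes "y \<in> X (Suc n)" "j < length (\<tau> n (y 0))" "j' < length (\<tau> n (y' 0))"
    "(shift ^^ j) (subst_seq (subst_word (\<tau> n)) y) = (shift ^^ j') (subst_seq (subst_word (\<tau> n)) y')"
  shows "j = j' \<and> y = y'"
proof (cases n)
  case 0
  then show ?thesis using recognizable_0 assms by blast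
next
  case (Suc m)
  let ?x = "(shift ^^ j) (subst_seq (subst_word (\<tau> n)) y)"
  have "?x \<in> X n" using assms(1) subst_seq_level_subshift shift_level_subshift by simp
  then have "(shift ^^ Suc (q m)) ?x \<noteq> ?x" by (rule no_period) simp
  then show ?thesis
    using recognizable_Suc[of j m j' ?x y y'] assms(2-4) unfolding Suc length_tau_Suc by blast
qed

lemma inj_on_subst_seq_tau_comp: "inj_on (subst_seq (h 0 n)) (X n)"
proof (induction n)
  case 0
  show ?case by (rule inj_onI) (simp only: subst_seq_tau_comp_refl)
next
  case (Suc n)
  show ?case
  proof (rule inj_onI)
    fix y y' assume y: "y \<in> X (Suc n)" "y' \<in> X (Suc n)"
      "subst_seq (h 0 (Suc n)) y = subst_seq (h 0 (Suc n)) y'"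
    then have "subst_seq (subst_word (\<tau> n)) y = subst_seq (subst_word (\<tau> n)) y'"
      using Suc subst_seq_level_subshift by (simp add: subst_seq_tau_comp_Suc inj_on_eq_iff)
    then show "y = y'" using recognizable[OF y(1), of 0 0 y'] by simp
  qed
qed

text \<open>By injectivity of \<open>subst_seq (h 0 n)\<close> on X^(n), a common point of two
  pieces gives two desubstitutions of one point of X^(n), which recognizability identifies.\<close>

lemma disjoint_occurrences:
  "disjoint_family_on (\<lambda>(c, j). (shift ^^ offset n c j) ` base (Suc n) c) (occurrences n b)"
proof -
  have "(c, j) = (c', j')"
    if cj: "(c, j) \<in> occurrences n b" "(c', j') \<in> occurrences n b"
      "z \<in> (shift ^^ offset n c j) ` base (Suc n) c" "z \<in> (shift ^^ offset n c' j') ` base (Suc n) c'"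
    for c j c' j' z
  proof -
    obtain y where y: "y \<in> X (Suc n)" "y 0 = c" "z = (shift ^^ offset n c j) (subst_seq (h 0 (Suc n)) y)"
      using cj(3) by (auto simp: base_def)
    obtain y' where y': "y' \<in> X (Suc n)" "y' 0 = c'" "z = (shift ^^ offset n c' j') (subst_seq (h 0 (Suc n)) y')"
      using cj(4) by (auto simp: base_def)
    let ?x = "(shift ^^ j) (subst_seq (subst_word (\<tau> n)) y)"
      and ?x' = "(shift ^^ j') (subst_seq (subst_word (\<tau> n)) y')"
    have j: "j < length (\<tau> n (y 0))" "j' < length (\<tau> n (y' 0))"
      using cj(1,2) y(2) y'(2) by (auto simp: occurrences_def)
    then have "subst_seq (h 0 n) ?x = subst_seq (h 0 n) ?x'"
      using subst_seq_tau_comp_shift_subst_seq y y' by simp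
    moreover have "?x \<in> X n" "?x' \<in> X n"
      using y(1) y'(1) subst_seq_level_subshift shift_level_subshift by simp_all
    ultimately have "?x = ?x'" by (rule inj_onD[OF inj_on_subst_seq_tau_comp])
    then show ?thesis using recognizable[of y n j j' y'] y(1) j y(2) y'(2) by simp
  qed
  then show ?thesis unfolding disjoint_family_on_def by fast
qed

section \<open>The invariant measure on bases and towers\<close>

lemma sets_eq: "sets \<mu> = sets (restrict_space borel (X 0))"
  using invariant by (simp add: invariant_prob_def level_subshift_0)

lemma space_eq: "space \<mu> = X 0"
  using sets_eq_imp_space_eq[OF sets_eq] by (simp add: space_restrict_space)

lemma compact_in_sets: "compact K \<Longrightarrow> K \<subseteq> X 0 \<Longrightarrow> K \<in> sets \<mu>"
  unfolding sets_eq sets_restrict_space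
  using borel_closed[OF compact_imp_closed_fun, of K] by blast

lemma measurable_shift: "shift \<in> measurable \<mu> \<mu>"
proof -
  have "shift \<in> measurable (restrict_space borel (X 0)) (restrict_space borel (X 0))"
    using shift_level_subshift[where k = 1]
    by (intro measurable_restrict_space3 borel_measurable_continuous_onI continuous_on_shift) auto
  then show ?thesis using measurable_cong_sets[OF sets_eq sets_eq] by blast
qed

text \<open>Invariance concerns preimages. Forward images of compact sets stay compact and hence
  measurable, and \<open>shift\<close> is injective, so the preimage of the image of
  \<open>?K\<close> is \<open>?K\<close> itself.\<close>

lemma measure_shift:
  assumes "compact K" "K \<subseteq> X 0"
  shows "measure \<mu> ((shift ^^ k) ` K) = measure \<mu> K"
proof (induction k)
  case (Suc k)
  let ?K = "(shift ^^ k) ` K"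
  have K: "?K \<subseteq> X 0" "shift ` ?K \<subseteq> X 0" "compact (shift ` ?K)"
    using assms shift_level_subshift[of _ 0 k] shift_level_subshift[of _ 0 "Suc k"]
      compact_shift_funpow[of K "Suc k"] by (auto simp: image_comp)
  have "distr \<mu> \<mu> shift = \<mu>" using invariant by (simp add: invariant_prob_def)
  then have "measure \<mu> (shift ` ?K) = measure (distr \<mu> \<mu> shift) (shift ` ?K)" by simp
  also have "\<dots> = measure \<mu> (shift -` (shift ` ?K) \<inter> space \<mu>)"
    using measurable_shift compact_in_sets K by (intro measure_distr) auto
  also have "shift -` (shift ` ?K) \<inter> space \<mu> = ?K"
    using K(1) by (auto simp: inj_vimage_image_eq[OF inj_shift] space_eq)
  finally show ?case using Suc by (simp add: image_comp)
qed simp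

lemma measure_base_sum:
  "measure \<mu> (base n b) =
     (\<Sum>c\<in>A (Suc n). real (card {j. j < length (\<tau> n c) \<and> \<tau> n c ! j = b}) * measure \<mu> (base (Suc n) c))"
proof -
  let ?F = "\<lambda>(c, j). (shift ^^ offset n c j) ` base (Suc n) c"
  have fin: "finite (occurrences n b)" by (simp add: occurrences_def finite_alphabet)
  have "?F ` occurrences n b \<subseteq> sets \<mu>"
    using compact_shift_funpow[OF compact_base] shift_base_subset compact_in_sets by auto
  then have "measure \<mu> (base n b) = (\<Sum>i\<in>occurrences n b. measure \<mu> (?F i))"
    unfolding base_decomposition[of n b]
    by (rule finite_measure_finite_Union[OF fin _ disjoint_occurrences])
  also have "\<dots> = (\<Sum>(c, j)\<in>occurrences n b. measure \<mu> (base (Suc n) c))"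
    by (intro sum.cong) (auto simp: measure_shift compact_base base_subset)
  also have "\<dots> = (\<Sum>c\<in>A (Suc n). \<Sum>j | j < length (\<tau> n c) \<and> \<tau> n c ! j = b. measure \<mu> (base (Suc n) c))"
    unfolding occurrences_def by (subst sum.Sigma) (auto simp: finite_alphabet)
  finally show ?thesis by simp
qed

text \<open>Double counting of the letters of \<tau>_n(c), grouped by value. Constant weights give
  the recursion for \<open>total_base\<close>; tower heights as weights give the conservation of
  total mass.\<close>

lemma weighted_base_sum:
  fixes w :: "nat \<Rightarrow> real"
  shows "(\<Sum>b\<in>A n. w b * measure \<mu> (base n b)) =
    (\<Sum>c\<in>A (Suc n). (\<Sum>a\<leftarrow>\<tau> n c. w a) * measure \<mu> (base (Suc n) c))"
proof -
  let ?J = "\<lambda>b c. {j. j < length (\<tau> n c) \<and> \<tau> n c ! j = b}"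
  have "(\<Sum>b\<in>A n. w b * measure \<mu> (base n b)) =
      (\<Sum>b\<in>A n. \<Sum>c\<in>A (Suc n). (\<Sum>j\<in>?J b c. w (\<tau> n c ! j)) * measure \<mu> (base (Suc n) c))"
    by (simp add: measure_base_sum[of n] sum_distrib_left mult_ac)
  also have "\<dots> = (\<Sum>c\<in>A (Suc n). (\<Sum>b\<in>A n. \<Sum>j\<in>?J b c. w (\<tau> n c ! j)) * measure \<mu> (base (Suc n) c))"
    by (subst sum.swap) (simp add: sum_distrib_right)
  also have "\<dots> = (\<Sum>c\<in>A (Suc n). (\<Sum>a\<leftarrow>\<tau> n c. w a) * measure \<mu> (base (Suc n) c))"
  proof (intro sum.cong refl arg_cong2[of _ _ _ _ "(*)"])
    fix c assume c: "c \<in> A (Suc n)"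
    have "(\<Sum>b\<in>A n. \<Sum>j\<in>?J b c. w (\<tau> n c ! j)) =
        (\<Sum>b\<in>A n. \<Sum>j\<in>{j. j \<in> {..<length (\<tau> n c)} \<and> \<tau> n c ! j = b}. w (\<tau> n c ! j))"
      by simp
    also have "\<dots> = (\<Sum>j<length (\<tau> n c). w (\<tau> n c ! j))"
      using set_tau[OF c] by (intro sum.group) (auto simp: finite_alphabet)
    finally show "(\<Sum>b\<in>A n. \<Sum>j\<in>?J b c. w (\<tau> n c ! j)) = (\<Sum>a\<leftarrow>\<tau> n c. w a)"
      by (simp add: sum_list_sum_nth atLeast0LessThan)
  qed
  finally show ?thesis .
qed

text \<open>The sum does not depend on \<open>n\<close>, since the height over \<open>c\<close> is
  the sum of the heights over the letters of \<tau>_n(c). At level 0 the heights are 1 and the two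
  cylinders partition the space.\<close>

lemma total_measure: "(\<Sum>b\<in>A n. real (length (h 0 n [b])) * measure \<mu> (base n b)) = 1"
proof (induction n)
  case 0
  have "(\<Sum>b\<in>A 0. measure \<mu> (base 0 b)) = measure \<mu> (\<Union>b\<in>A 0. base 0 b)"
  proof (rule finite_measure_finite_Union[symmetric])
    show "disjoint_family_on (base 0) (A 0)" by (auto simp: disjoint_family_on_def base_0)
    show "base 0 ` A 0 \<subseteq> sets \<mu>" using compact_in_sets[OF compact_base base_subset] by blast
  qed (rule finite_alphabet)
  also have "(\<Union>b\<in>A 0. base 0 b) = space \<mu>"
    using letter_in_alphabet by (auto simp: base_0 space_eq)
  finally show ?case using prob_space by simp
next
  case (Suc n)
  have "(\<Sum>a\<leftarrow>u. real (length (h 0 n [a]))) = real (\<Sum>a\<leftarrow>u. length (h 0 n [a]))" for u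
    by (induction u) auto
  then have "(\<Sum>a\<leftarrow>\<tau> n c. real (length (h 0 n [a]))) = real (length (h 0 (Suc n) [c]))" for c
    using length_tau_comp_sum[of n "\<tau> n c"] by (simp add: tau_comp_Suc)
  then show ?case using Suc weighted_base_sum[of "\<lambda>a. real (length (h 0 n [a]))" n] by simp
qed

text \<open>The towers cover the space, while the total mass of their levels is 1; hence the levels of each
  tower are disjoint up to null sets.\<close>

lemma measure_tower:
  assumes b: "b \<in> A n"
  shows "measure \<mu> (tower q s n b) = real (length (h 0 n [b])) * measure \<mu> (base n b)"
proof -
  let ?g = "\<lambda>b. real (length (h 0 n [b])) * measure \<mu> (base n b)"
  have lev: "(shift ^^ k) ` base n b \<in> sets \<mu>" for k b
    by (intro compact_in_sets compact_shift_funpow compact_base shift_base_subset)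
  then have sets: "tower q s n b \<in> sets \<mu>" for b by (auto simp: tower_eq)
  have le: "measure \<mu> (tower q s n b) \<le> ?g b" for b
  proof -
    have "measure \<mu> (tower q s n b) \<le> (\<Sum>k<length (h 0 n [b]). measure \<mu> ((shift ^^ k) ` base n b))"
      unfolding tower_eq using lev by (intro finite_measure_subadditive_finite) auto
    then show ?thesis by (simp add: measure_shift compact_base base_subset)
  qed
  have "1 \<le> measure \<mu> (\<Union>b\<in>A n. tower q s n b)"
    using towers_cover[of n] sets finite_alphabet
    by (subst prob_space[symmetric]) (auto intro!: finite_measure_mono simp: space_eq)
  also have "\<dots> \<le> (\<Sum>b\<in>A n. measure \<mu> (tower q s n b))"
    using sets by (intro finite_measure_subadditive_finite finite_alphabet) auto
  finally have "(\<Sum>b\<in>A n. ?g b - measure \<mu> (tower q s n b)) \<le> 0"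
    using total_measure[of n] by (simp add: sum_subtractf)
  moreover have "?g b - measure \<mu> (tower q s n b) \<le> (\<Sum>b\<in>A n. ?g b - measure \<mu> (tower q s n b))"
    using b finite_alphabet le by (intro member_le_sum) auto
  ultimately show ?thesis using le[of b] by linarith
qed

section \<open>Letter frequencies and the spacer series\<close>

definition total_base :: "nat \<Rightarrow> real" where
  "total_base n = (\<Sum>b\<in>A n. measure \<mu> (base n b))"

lemma measure_base_le_total: "measure \<mu> (base n b) \<le> total_base n"
proof (cases "b \<in> A n")
  case True
  then show ?thesis unfolding total_base_def
    by (intro member_le_sum finite_alphabet) auto
qed (simp add: base_empty total_base_def sum_nonneg)

lemma total_base_pos: "total_base n > 0"
proof -
  have "total_base n \<noteq> 0"
  proof
    assume "total_base n = 0"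
    then have "\<forall>b\<in>A n. measure \<mu> (base n b) = 0"
      unfolding total_base_def by (simp add: sum_nonneg_eq_0_iff finite_alphabet)
    then show False using total_measure[of n] by simp
  qed
  moreover have "total_base n \<ge> 0" unfolding total_base_def by (simp add: sum_nonneg)
  ultimately show ?thesis by simp
qed

lemma total_base_Suc: "total_base (Suc m) = real (q m + 1) * total_base (Suc (Suc m))"
  using weighted_base_sum[of "\<lambda>_. 1" "Suc m"]
  by (simp add: total_base_def sum_list_triv length_tau_Suc sum_distrib_left)

lemma measure_base_Suc:
  "measure \<mu> (base (Suc m) b) =
     real (spacer_count q s (Suc m) b) * total_base (Suc (Suc m)) + measure \<mu> (base (Suc (Suc m)) b)"
proof -
  let ?e = "\<lambda>c. measure \<mu> (base (Suc (Suc m)) c)"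
  have "measure \<mu> (base (Suc m) b) =
      (\<Sum>c\<in>A (Suc (Suc m)). real (spacer_count q s (Suc m) b) * ?e c + (if b = c then ?e c else 0))"
    unfolding measure_base_sum[of "Suc m"] card_occurrences_Suc
    by (intro sum.cong) (auto simp: algebra_simps)
  also have "\<dots> = real (spacer_count q s (Suc m) b) * total_base (Suc (Suc m)) +
      (if b \<in> A (Suc (Suc m)) then ?e b else 0)"
    by (simp add: sum.distrib total_base_def sum_distrib_left sum.delta finite_alphabet)
  \<comment> \<open>If \<open>b\<close> has left the alphabet of the next level, its base there is
    empty, so both cases give the same formula.\<close>
  finally show ?thesis by (simp add: base_empty)
qed

lemma cut_prod_Suc: "cut_prod q m (m + Suc k) = cut_prod q m (m + k) * (q (m + k) + 1)"
  by (simp add: cut_prod_def)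

lemma cut_prod_ge: "2 ^ k \<le> cut_prod q m (m + k)"
proof (induction k)
  case (Suc k)
  have "2 ^ k * 2 \<le> cut_prod q m (m + k) * (q (m + k) + 1)"
    using Suc q_ge[of "m + k"] by (intro mult_le_mono) auto
  then show ?case unfolding cut_prod_Suc by simp
qed (simp add: cut_prod_def)

lemma total_base_cut_prod:
  "total_base (Suc m) = real (cut_prod q m (m + k)) * total_base (Suc m + k)"
proof (induction k)
  case (Suc k)
  then show ?case using total_base_Suc[of "m + k"] unfolding cut_prod_Suc by (simp add: algebra_simps)
qed (simp add: cut_prod_def)

text \<open>Iterating \<open>measure_base_Suc\<close> expresses the base measure as
  \<open>?T\<close> times a partial sum plus a base measure of a later level. That remainder is at
  most \<open>total_base\<close>, which at least halves from level to level.\<close>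

lemma spacer_series_sums:
  "(\<lambda>k. real (spacer_count q s (Suc m + k) b) / real (cut_prod q m (Suc m + k))) sums
     (measure \<mu> (base (Suc m) b) / total_base (Suc m))"
proof -
  let ?f = "\<lambda>k. real (spacer_count q s (Suc m + k) b) / real (cut_prod q m (Suc m + k))"
  let ?e = "\<lambda>n. measure \<mu> (base n b)" and ?T = "total_base (Suc m)"
  have cut: "real (cut_prod q m (m + k)) > 0" for k
    using less_le_trans[OF _ cut_prod_ge[of k m], of 0] by simp
  have partial: "?e (Suc m) = ?T * (\<Sum>k<K. ?f k) + ?e (Suc m + K)" for K
  proof (induction K)
    case (Suc K)
    have "total_base (Suc (Suc m + K)) = ?T / real (cut_prod q m (Suc m + K))"
      using total_base_cut_prod[of m "Suc K"] cut[of "Suc K"] by (simp add: field_simps)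
    then have "?e (Suc m + K) = ?T * ?f K + ?e (Suc m + Suc K)"
      using measure_base_Suc[of "m + K" b] by simp
    then show ?case using Suc by (simp add: algebra_simps)
  qed simp
  have upper: "?e (Suc m + K) \<le> ?T * (1 / 2) ^ K" for K
  proof -
    have "real (2 ^ K) \<le> real (cut_prod q m (m + K))" using cut_prod_ge by (rule of_nat_mono)
    then have "total_base (Suc m + K) * real (2 ^ K) \<le> total_base (Suc m + K) * real (cut_prod q m (m + K))"
      using total_base_pos[of "Suc m + K"] by (intro mult_left_mono) auto
    also have "\<dots> = ?T" using total_base_cut_prod[of m K] by simp
    finally have "total_base (Suc m + K) \<le> ?T * (1 / 2) ^ K" by (simp add: field_simps)
    with measure_base_le_total show ?thesis by (rule order.trans)
  qed
  have lim: "(\<lambda>K. ?T * (1 / 2) ^ K) \<longlonglongrightarrow> 0"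
    by (intro tendsto_mult_right_zero LIMSEQ_power_zero) simp
  have "(\<lambda>K. ?e (Suc m + K)) \<longlonglongrightarrow> 0"
    by (rule tendsto_sandwich[OF _ _ tendsto_const lim])
      (simp, intro always_eventually allI upper)
  then have "(\<lambda>K. (?e (Suc m) - ?e (Suc m + K)) / ?T) \<longlonglongrightarrow> (?e (Suc m) - 0) / ?T"
    by (intro tendsto_intros) (use total_base_pos[of "Suc m"] in auto)
  moreover have "(\<Sum>k<K. ?f k) = (?e (Suc m) - ?e (Suc m + K)) / ?T" for K
    using partial[of K] total_base_pos[of "Suc m"] by (simp add: field_simps)
  ultimately show ?thesis by (simp add: sums_def)
qed

lemma spacer_series_eq:
  "spacer_series q s b (Suc m) = measure \<mu> (base (Suc m) b) / total_base (Suc m)"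
  using sums_unique[OF spacer_series_sums[of m b]] by (simp add: spacer_series_def)

lemma length_gen_word_pos: "length (W n) > 0"
  using prefix_length_le[OF prefix_gen_word[of 0 n]] by (simp add: Suc_le_eq)

text \<open>All heights of level \<open>n\<close> lie between \<open>w\<close> and
  \<open>C * w\<close>, so total mass 1 forces \<open>w * T\<close> between \<open>1 / C\<close> and
  1. The tower measure is its height times \<open>F * T\<close>, with \<open>F\<close> the spacer
  series.\<close>

lemma tower_comparable:
  "\<exists>C>0. \<forall>n>0. \<forall>b\<in>A n. spacer_series q s b n / C \<le> measure \<mu> (tower q s n b) \<and>
     measure \<mu> (tower q s n b) \<le> C * spacer_series q s b n"
proof -
  obtain B where B: "\<And>n a. n > 0 \<Longrightarrow> a \<in> A n \<Longrightarrow> a \<le> B" using alphabet_bounded by blast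
  \<comment> \<open>From |w_m| + a \<le> (1 + B) |w_m|, using a \<le> B and |w_m| \<ge> 1.\<close>
  define C where "C = 1 + real B"
  have C: "C > 0" by (simp add: C_def)
  have "spacer_series q s b n / C \<le> measure \<mu> (tower q s n b) \<and>
     measure \<mu> (tower q s n b) \<le> C * spacer_series q s b n" if n: "n > 0" and b: "b \<in> A n" for n b
  proof -
    obtain m where m: "n = Suc m" using n by (cases n) auto
    define F w T where "F = spacer_series q s b n" and "w = real (length (W m))" and "T = total_base n"
    have T: "T > 0" by (simp add: T_def total_base_pos)
    have w: "w \<ge> 1" using length_gen_word_pos[of m] by (simp add: w_def Suc_le_eq)
    have F: "measure \<mu> (base n b) = F * T" "F \<ge> 0"
      using T by (simp_all add: F_def T_def m spacer_series_eq)
    have len: "w \<le> real (length (h 0 n [a]))" "real (length (h 0 n [a])) \<le> C * w" if "a \<in> A n" for a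
    proof -
      have "real B \<le> real B * w" using w by (simp add: mult_le_cancel_left1)
      then show "w \<le> real (length (h 0 n [a]))" "real (length (h 0 n [a])) \<le> C * w"
        using B[OF n that] by (simp_all add: m length_tau_comp w_def C_def algebra_simps)
    qed
    have "w * T \<le> (\<Sum>a\<in>A n. real (length (h 0 n [a])) * measure \<mu> (base n a))"
      unfolding T_def total_base_def sum_distrib_left
      by (intro sum_mono mult_right_mono len(1)) auto
    then have le1: "w * T \<le> 1" using total_measure[of n] by simp
    have "(\<Sum>a\<in>A n. real (length (h 0 n [a])) * measure \<mu> (base n a)) \<le> (C * w) * T"
      unfolding T_def total_base_def sum_distrib_left[of "C * w"]
      by (intro sum_mono mult_right_mono len(2)) auto
    then have ge1: "1 \<le> C * (w * T)" using total_measure[of n] by (simp add: mult.assoc)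
    have tow: "measure \<mu> (tower q s n b) = real (length (h 0 n [b])) * (F * T)"
      using measure_tower[OF b] F(1) by simp
    have "F / C \<le> F * (w * T)"
      using mult_left_mono[OF ge1 F(2)] C by (simp add: field_simps)
    also have "\<dots> \<le> measure \<mu> (tower q s n b)"
      unfolding tow using mult_right_mono[OF len(1)[OF b], of "F * T"] F(2) T by (simp add: mult_ac)
    finally have lower: "F / C \<le> measure \<mu> (tower q s n b)" .
    have "measure \<mu> (tower q s n b) \<le> C * w * (F * T)"
      unfolding tow using len(2)[OF b] F(2) T by (intro mult_right_mono) auto
    also have "\<dots> = (C * F) * (w * T)" by simp
    also have "\<dots> \<le> C * F" using mult_left_mono[OF le1, of "C * F"] C F(2) by simp
    finally show ?thesis using lower by (simp add: F_def)
  qed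
  then show ?thesis using C by blast
qed

text \<open>The letter is a spacer of some stage N \<ge> m, so its base at level N+1 has positive
  measure by the recursion, and descending to level m+1 only adds mass.\<close>

lemma measure_base_pos:
  assumes "b \<in> A (Suc m)"
  shows "measure \<mu> (base (Suc m) b) > 0"
proof -
  obtain N i where N: "b = s N i" "N \<ge> m" "i < q N" using assms by (auto simp: alphabet_def)
  have "card {i. i < q N \<and> s N i = b} > 0" using N by (auto simp: card_gt_0_iff)
  then have "real (spacer_count q s (Suc N) b) * total_base (Suc (Suc N)) > 0"
    using total_base_pos by (simp add: spacer_count_def)
  then have "0 < measure \<mu> (base (Suc N) b)" unfolding measure_base_Suc[of N] by (simp add: add_pos_nonneg)
  also have "measure \<mu> (base (Suc N) b) \<le> measure \<mu> (base (Suc m) b)"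
    using \<open>m \<le> N\<close>
  proof (induction rule: dec_induct)
    case (step k)
    have "0 \<le> real (spacer_count q s (Suc k) b) * total_base (Suc (Suc k))"
      using total_base_pos[of "Suc (Suc k)"] by simp
    then show ?case using step measure_base_Suc[of k b] by linarith
  qed simp
  finally show ?thesis .
qed

lemma measure_tower_pos:
  assumes "n > 0" "b \<in> A n"
  shows "measure \<mu> (tower q s n b) > 0"
proof -
  obtain m where m: "n = Suc m" using assms(1) by (cases n) auto
  then show ?thesis
    using measure_tower[OF assms(2)] measure_base_pos[of b m] assms(2) by simp
qed

end

section \<open>Lower limits, uniform bounds and the conclusion\<close>

lemma liminf_pos_iff:
  "liminf (\<lambda>n. ereal (u n)) > 0 \<longleftrightarrow> (\<exists>c>0. \<forall>\<^sub>F n in sequentially. c \<le> u n)"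
proof
  assume "liminf (\<lambda>n. ereal (u n)) > 0"
  then obtain y where y: "0 < y" "y < liminf (\<lambda>n. ereal (u n))" using dense by blast
  then obtain c where c: "y = ereal c" by (cases y) auto
  have "\<forall>\<^sub>F n in sequentially. y < ereal (u n)" by (rule less_LiminfD[OF y(2)])
  then have "\<forall>\<^sub>F n in sequentially. c \<le> u n" by eventually_elim (simp add: c)
  then show "\<exists>c>0. \<forall>\<^sub>F n in sequentially. c \<le> u n" using y(1) c by auto
next
  assume "\<exists>c>0. \<forall>\<^sub>F n in sequentially. c \<le> u n"
  then obtain c where c: "c > 0" "\<forall>\<^sub>F n in sequentially. c \<le> u n" by blast
  have "ereal c \<le> liminf (\<lambda>n. ereal (u n))"
    using c(2) by (intro Liminf_bounded) (simp add: eventually_mono)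
  then show "liminf (\<lambda>n. ereal (u n)) > 0" using c(1) by (metis ereal_less(2) less_le_trans)
qed

text \<open>For each letter, the eventual bound extends to all levels from \<open>n\<^sub>0\<close>
  on by a minimum over the finitely many earlier ones, where the measure is positive. A minimum over
  the finite alphabet then gives one constant.\<close>

lemma exact_finite_rankI:
  assumes "finite (limit_alphabet q s)"
    and "\<And>b n. b \<in> limit_alphabet q s \<Longrightarrow> n \<ge> n\<^sub>0 \<Longrightarrow> measure M (tower q s n b) > 0"
    and "\<And>b. b \<in> limit_alphabet q s \<Longrightarrow> liminf (\<lambda>n. ereal (measure M (tower q s n b))) > 0"
  shows "exact_finite_rank q s M n\<^sub>0"
proof -
  let ?u = "\<lambda>n b. measure M (tower q s n b)"
  have "\<exists>c>0. \<forall>n\<ge>n\<^sub>0. c \<le> ?u n b" if b: "b \<in> limit_alphabet q s" for b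
  proof -
    obtain c N where c: "c > 0" "\<And>n. n \<ge> N \<Longrightarrow> c \<le> ?u n b"
      using assms(3)[OF b] unfolding liminf_pos_iff eventually_sequentially by blast
    let ?S = "insert c ((\<lambda>n. ?u n b) ` {n\<^sub>0..<N})"
    have "Min ?S > 0" using c(1) assms(2)[OF b] by auto
    moreover have "Min ?S \<le> ?u n b" if "n \<ge> n\<^sub>0" for n
    proof (cases "n < N")
      case True
      then show ?thesis using that by (intro Min_le) auto
    next
      case False
      have "Min ?S \<le> c" by (intro Min_le) auto
      also have "c \<le> ?u n b" using c(2) False by simp
      finally show ?thesis .
    qed
    ultimately show ?thesis by blast
  qed
  then obtain c where c: "\<And>b. b \<in> limit_alphabet q s \<Longrightarrow> c b > 0"
    "\<And>b n. b \<in> limit_alphabet q s \<Longrightarrow> n \<ge> n\<^sub>0 \<Longrightarrow> c b \<le> ?u n b" by metis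
  let ?S = "insert 1 (c ` limit_alphabet q s)"
  have "Min ?S > 0" using c(1) assms(1) by auto
  moreover have "Min ?S \<le> ?u n b" if "b \<in> limit_alphabet q s" "n \<ge> n\<^sub>0" for n b
  proof -
    have "Min ?S \<le> c b" using that(1) assms(1) by (intro Min_le) auto
    also have "c b \<le> ?u n b" by (rule c(2)[OF that])
    finally show ?thesis .
  qed
  ultimately show ?thesis unfolding exact_finite_rank_def by blast
qed

theorem proposition4p4:
  fixes q :: "nat \<Rightarrow> nat" and s :: "nat \<Rightarrow> nat \<Rightarrow> nat"
    and \<mu> :: "(int \<Rightarrow> nat) measure" and n\<^sub>0 :: nat
  assumes "standard q"
    and "bounded_spacers q s"
    and "aperiodic (ferenczi_subshift q s)"
    and "invariant_prob (ferenczi_subshift q s) \<mu>"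
    and "n\<^sub>0 \<ge> 1"
    and "\<And>n. n \<ge> n\<^sub>0 \<Longrightarrow> alphabet q s n = limit_alphabet q s"
  shows "(\<forall>b\<in>limit_alphabet q s.
            liminf (\<lambda>m. ereal (measure \<mu> (tower q s m b))) > 0 \<longleftrightarrow> spacer_condition q s b) \<and>
         (exact_finite_rank q s \<mu> n\<^sub>0 \<longleftrightarrow> (\<forall>b\<in>limit_alphabet q s. spacer_condition q s b))"
proof -
  interpret aperiodic_ferenczi q s \<mu>
    using assms by unfold_locales (auto simp: standard_def)
  obtain C where C: "C > 0" and comp: "\<And>n b. n > 0 \<Longrightarrow> b \<in> alphabet q s n \<Longrightarrow>
      spacer_series q s b n / C \<le> measure \<mu> (tower q s n b) \<and>
      measure \<mu> (tower q s n b) \<le> C * spacer_series q s b n"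
    using tower_comparable by blast
  \<comment> \<open>The comparison holds from \<open>n\<^sub>0\<close> on, where the level is
    positive and every letter of the limit alphabet belongs to the alphabet of the level.\<close>
  have ev: "\<forall>\<^sub>F n in sequentially. spacer_series q s b n / C \<le> measure \<mu> (tower q s n b) \<and>
      measure \<mu> (tower q s n b) \<le> C * spacer_series q s b n" if "b \<in> limit_alphabet q s" for b
    using eventually_ge_at_top[of n\<^sub>0]
  proof eventually_elim
    case (elim n)
    then show ?case using comp[of n b] assms(5,6) that by simp
  qed
  have iff: "liminf (\<lambda>m. ereal (measure \<mu> (tower q s m b))) > 0 \<longleftrightarrow> spacer_condition q s b"
    if b: "b \<in> limit_alphabet q s" for b
    unfolding spacer_condition_def liminf_pos_iff
  proof
    assume "\<exists>c>0. \<forall>\<^sub>F n in sequentially. c \<le> measure \<mu> (tower q s n b)"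
    then obtain c where c: "c > 0" "\<forall>\<^sub>F n in sequentially. c \<le> measure \<mu> (tower q s n b)" by blast
    have "\<forall>\<^sub>F n in sequentially. c / C \<le> spacer_series q s b n"
      using c(2) ev[OF b] by eventually_elim (use C in \<open>auto simp: field_simps\<close>)
    then show "\<exists>c>0. \<forall>\<^sub>F n in sequentially. c \<le> spacer_series q s b n"
      using c(1) C by (intro exI[of _ "c / C"]) simp
  next
    assume "\<exists>c>0. \<forall>\<^sub>F n in sequentially. c \<le> spacer_series q s b n"
    then obtain c where c: "c > 0" "\<forall>\<^sub>F n in sequentially. c \<le> spacer_series q s b n" by blast
    have "\<forall>\<^sub>F n in sequentially. c / C \<le> measure \<mu> (tower q s n b)"
      using c(2) ev[OF b] by eventually_elim (use C in \<open>auto simp: field_simps\<close>)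
    then show "\<exists>c>0. \<forall>\<^sub>F n in sequentially. c \<le> measure \<mu> (tower q s n b)"
      using c(1) C by (intro exI[of _ "c / C"]) simp
  qed
  have "exact_finite_rank q s \<mu> n\<^sub>0 \<longleftrightarrow>
      (\<forall>b\<in>limit_alphabet q s. liminf (\<lambda>m. ereal (measure \<mu> (tower q s m b))) > 0)"
  proof
    assume "exact_finite_rank q s \<mu> n\<^sub>0"
    then show "\<forall>b\<in>limit_alphabet q s. liminf (\<lambda>m. ereal (measure \<mu> (tower q s m b))) > 0"
      unfolding exact_finite_rank_def liminf_pos_iff eventually_sequentially by blast
  next
    assume lim: "\<forall>b\<in>limit_alphabet q s. liminf (\<lambda>m. ereal (measure \<mu> (tower q s m b))) > 0"
    show "exact_finite_rank q s \<mu> n\<^sub>0"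
    proof (rule exact_finite_rankI)
      show "finite (limit_alphabet q s)" using finite_alphabet[of n\<^sub>0] assms(6) by simp
      show "measure \<mu> (tower q s n b) > 0" if "b \<in> limit_alphabet q s" "n \<ge> n\<^sub>0" for b n
        using measure_tower_pos[of n b] assms(5,6) that by simp
    qed (use lim in blast)
  qed
  then show ?thesis using iff by blast
qed

end
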